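(* Let $f\in\mathbb{Z}[t_1,\dots,t_n]$ be a nondegenerate $n$-ary quadratic form. Then \[ \delta_{\mathrm{loc}}(f)=\prod_p \delta_p(f), \] the product extending over all prime numbers.
   Context: An integer $m$ is locally represented by $f$ if $f$ represents $m$ over $\mathbb{R}$ and over $\mathbb{Z}_p$ for every prime $p$; $D_{f,\mathrm{loc}}$ is the set of integers locally represented by $f$. For $S\subset\mathbb{Z}$: $S$ is positive if it contains no negative integers, negative if it contains no positive integers, indefinite otherwise; its density is $\lim_{N\to\infty}\#(S\cap[1,N])/N$, $\lim_{N\to\infty}\#(S\cap[-N,-1])/N$, or $\lim_{N\to\infty}\#(S\cap[-N,N])/(2N)$ respectively (limit required to exist). $\delta_{\mathrm{loc}}(f)$ is the density of $D_{f,\mathrm{loc}}$. $\mu_p$ is the Haar measure on $\mathbb{Z}_p$ with $\mu_p(\mathbb{Z}_p)=1$ and $\delta_p(f)\coloneqq\mu_p(f(\mathbb{Z}_p^n))$. *)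

theory Defs
  imports "HOL-Probability.Probability" "HOL-Algebra.Algebraic_Closure_Type"
begin

hide_const (open) Divisibility.prime

section \<open>The ring of p-adic integers and its Haar measure\<close>

text \<open>
  The p-adic integers are the inverse limit of the rings of integers modulo \<open>p ^ k\<close>: an element
  is a compatible sequence of residues, the \<open>k\<close>-th one being represented in \<open>{0..<p ^ k}\<close>.
\<close>

definition padic_int :: "nat \<Rightarrow> (nat \<Rightarrow> int) ring" where
  "padic_int p =
    \<lparr>carrier = {x. \<forall>k. x k \<in> {0..<int p ^ k} \<and> x (Suc k) mod int p ^ k = x k},
     monoid.mult = (\<lambda>x y k. (x k * y k) mod int p ^ k),
     one = (\<lambda>k. 1 mod int p ^ k),
     ring.zero = (\<lambda>k. 0),
     add = (\<lambda>x y k. (x k + y k) mod int p ^ k)\<rparr>"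

definition padic_topology :: "nat \<Rightarrow> (nat \<Rightarrow> int) topology" where
  "padic_topology p =
     subtopology (product_topology (\<lambda>_. discrete_topology UNIV) UNIV) (carrier (padic_int p))"

definition padic_borel :: "nat \<Rightarrow> (nat \<Rightarrow> int) measure" where
  "padic_borel p = sigma (carrier (padic_int p)) {U. openin (padic_topology p) U}"

definition is_padic_haar :: "nat \<Rightarrow> (nat \<Rightarrow> int) measure \<Rightarrow> bool" where
  "is_padic_haar p M \<longleftrightarrow>
     sets M = sets (padic_borel p) \<and>
     emeasure M (carrier (padic_int p)) = 1 \<and>
     (\<forall>a \<in> carrier (padic_int p). \<forall>A \<in> sets M.
        emeasure M ((\<lambda>x. a \<oplus>\<^bsub>padic_int p\<^esub> x) ` A) = emeasure M A)"

text \<open>Existence and uniqueness are proved below (\<open>padic_haar_unique\<close>).\<close>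

definition padic_haar :: "nat \<Rightarrow> (nat \<Rightarrow> int) measure" where
  "padic_haar p = (THE M. is_padic_haar p M)"


section \<open>Integral quadratic forms\<close>

text \<open>
  The form \<open>\<Sum>\<^sub>i\<^sub>\<le>\<^sub>j c\<^sub>i\<^sub>j t\<^sub>i t\<^sub>j\<close> in \<open>n\<close> variables (indexed by \<open>{..<n}\<close>) is given by its
  integer coefficients \<open>c i j\<close> for \<open>i \<le> j < n\<close>; all other values of \<open>c\<close> are irrelevant.
  It is evaluated in an arbitrary commutative ring \<open>R\<close> via the canonical map from the integers.
\<close>

definition qf_eval ::
  "('a, 'b) ring_scheme \<Rightarrow> nat \<Rightarrow> (nat \<Rightarrow> nat \<Rightarrow> int) \<Rightarrow> (nat \<Rightarrow> 'a) \<Rightarrow> 'a" where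
  "qf_eval R n c x =
     (\<Oplus>\<^bsub>R\<^esub>j\<in>{..<n}. \<Oplus>\<^bsub>R\<^esub>i\<in>{..j}. [c i j] \<cdot>\<^bsub>R\<^esub> (x i \<otimes>\<^bsub>R\<^esub> x j))"

definition qf_values ::
  "('a, 'b) ring_scheme \<Rightarrow> nat \<Rightarrow> (nat \<Rightarrow> nat \<Rightarrow> int) \<Rightarrow> 'a set" where
  "qf_values R n c = qf_eval R n c ` ({..<n} \<rightarrow> carrier R)"

definition qf_represents ::
  "('a, 'b) ring_scheme \<Rightarrow> nat \<Rightarrow> (nat \<Rightarrow> nat \<Rightarrow> int) \<Rightarrow> int \<Rightarrow> bool" where
  "qf_represents R n c m \<longleftrightarrow> [m] \<cdot>\<^bsub>R\<^esub> \<one>\<^bsub>R\<^esub> \<in> qf_values R n c"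

definition qf_polar :: "nat \<Rightarrow> (nat \<Rightarrow> nat \<Rightarrow> int) \<Rightarrow> (nat \<Rightarrow> rat) \<Rightarrow> (nat \<Rightarrow> rat) \<Rightarrow> rat" where
  "qf_polar n c x y =
     qf_eval ring_of_type_algebra n c (\<lambda>i. x i + y i)
     - qf_eval ring_of_type_algebra n c x - qf_eval ring_of_type_algebra n c y"

text \<open>The associated bilinear form on the n-dimensional rational space has trivial radical.\<close>

definition qf_nondegenerate :: "nat \<Rightarrow> (nat \<Rightarrow> nat \<Rightarrow> int) \<Rightarrow> bool" where
  "qf_nondegenerate n c \<longleftrightarrow> (\<forall>x. (\<forall>y. qf_polar n c x y = 0) \<longrightarrow> (\<forall>i<n. x i = 0))"


section \<open>Local representation and densities\<close>

definition locally_represented :: "nat \<Rightarrow> (nat \<Rightarrow> nat \<Rightarrow> int) \<Rightarrow> int set" where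
  "locally_represented n c =
     {m. qf_represents (ring_of_type_algebra :: real ring) n c m \<and>
         (\<forall>p. prime p \<longrightarrow> qf_represents (padic_int p) n c m)}"

definition local_measure :: "nat \<Rightarrow> nat \<Rightarrow> (nat \<Rightarrow> nat \<Rightarrow> int) \<Rightarrow> real" where
  "local_measure p n c = measure (padic_haar p) (qf_values (padic_int p) n c)"

text \<open>
  A subset of \<open>{0}\<close> is both positive and negative; its density is \<open>0\<close> in either sense, so the
  order of the case distinction does not matter.
\<close>

definition has_density :: "int set \<Rightarrow> real \<Rightarrow> bool" where
  "has_density S d \<longleftrightarrow>
     (if \<forall>m\<in>S. \<not> m < 0 then
        (\<lambda>N::nat. real (card (S \<inter> {1..int N})) / real N) \<longlonglongrightarrow> d
      else if \<forall>m\<in>S. \<not> m > 0 then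
        (\<lambda>N::nat. real (card (S \<inter> {- int N..-1})) / real N) \<longlonglongrightarrow> d
      else
        (\<lambda>N::nat. real (card (S \<inter> {- int N..int N})) / (2 * real N)) \<longlonglongrightarrow> d)"


section \<open>Well-definedness\<close>

lemma padic_int_simps:
  "carrier (padic_int p) = {x. \<forall>k. x k \<in> {0..<int p ^ k} \<and> x (Suc k) mod int p ^ k = x k}"
  "x \<otimes>\<^bsub>padic_int p\<^esub> y = (\<lambda>k. (x k * y k) mod int p ^ k)"
  "\<one>\<^bsub>padic_int p\<^esub> = (\<lambda>k. 1 mod int p ^ k)"
  "\<zero>\<^bsub>padic_int p\<^esub> = (\<lambda>k. 0)"
  "x \<oplus>\<^bsub>padic_int p\<^esub> y = (\<lambda>k. (x k + y k) mod int p ^ k)"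
  by (simp_all add: padic_int_def)

lemma padic_int_memD:
  assumes "x \<in> carrier (padic_int p)"
  shows "0 \<le> x k" "x k < int p ^ k" "x (Suc k) mod int p ^ k = x k" "x k mod int p ^ k = x k"
  using assms by (auto simp: padic_int_simps)

lemma padic_int_mod:
  assumes "x \<in> carrier (padic_int p)" "k \<le> l"
  shows "x l mod int p ^ k = x k"
  using assms(2)
proof (induction l rule: dec_induct)
  case base
  then show ?case using assms(1) by (simp add: padic_int_memD)
next
  case (step l)
  have "int p ^ k dvd int p ^ l" using step by (simp add: le_imp_power_dvd)
  then have "x (Suc l) mod int p ^ k = x (Suc l) mod int p ^ l mod int p ^ k"
    by (simp add: mod_mod_cancel)
  also have "\<dots> = x k" using step assms(1) by (simp add: padic_int_memD)
  finally show ?case .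
qed

lemma mod_power_Suc_mod: "(a::int) mod int p ^ Suc k mod int p ^ k = a mod int p ^ k"
  by (rule mod_mod_cancel) simp

lemma padic_int_closed:
  assumes "p > 0" "\<And>k. f (Suc k) mod int p ^ k = f k mod int p ^ k"
  shows "(\<lambda>k. f k mod int p ^ k) \<in> carrier (padic_int p)"
  using assms by (auto simp: padic_int_simps mod_power_Suc_mod simp del: power_Suc)

lemma cring_padic_int:
  assumes p: "p > 0"
  shows "cring (padic_int p)"
proof (rule cringI)
  let ?R = "padic_int p"
  have addc: "x \<oplus>\<^bsub>?R\<^esub> y \<in> carrier ?R" if "x \<in> carrier ?R" "y \<in> carrier ?R" for x y
    unfolding padic_int_simps(5)
  proof (rule padic_int_closed[OF p])
    show "(x (Suc k) + y (Suc k)) mod int p ^ k = (x k + y k) mod int p ^ k" for k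
      using that by (metis mod_add_eq padic_int_memD(3,4))
  qed
  have mulc: "x \<otimes>\<^bsub>?R\<^esub> y \<in> carrier ?R" if "x \<in> carrier ?R" "y \<in> carrier ?R" for x y
    unfolding padic_int_simps(2)
  proof (rule padic_int_closed[OF p])
    show "(x (Suc k) * y (Suc k)) mod int p ^ k = (x k * y k) mod int p ^ k" for k
      using that by (metis mod_mult_eq padic_int_memD(3,4))
  qed
  have zc: "\<zero>\<^bsub>?R\<^esub> \<in> carrier ?R" and oc: "\<one>\<^bsub>?R\<^esub> \<in> carrier ?R"
    using padic_int_closed[OF p, of "\<lambda>_. 0"] padic_int_closed[OF p, of "\<lambda>_. 1"]
    by (simp_all add: padic_int_simps(3,4))
  show "abelian_group ?R"
  proof (rule abelian_groupI)
    fix x assume x: "x \<in> carrier ?R"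
    let ?y = "\<lambda>k. (- x k) mod int p ^ k"
    have "?y \<in> carrier ?R"
    proof (rule padic_int_closed[OF p])
      show "- x (Suc k) mod int p ^ k = - x k mod int p ^ k" for k
        using x by (metis mod_minus_eq padic_int_memD(3))
    qed
    moreover have "?y \<oplus>\<^bsub>?R\<^esub> x = \<zero>\<^bsub>?R\<^esub>"
      by (simp add: padic_int_simps(4,5) mod_add_left_eq)
    ultimately show "\<exists>y\<in>carrier ?R. y \<oplus>\<^bsub>?R\<^esub> x = \<zero>\<^bsub>?R\<^esub>" by blast
    show "\<zero>\<^bsub>?R\<^esub> \<oplus>\<^bsub>?R\<^esub> x = x"
      using x by (simp add: padic_int_simps(4,5) padic_int_memD)
  qed (use addc zc in \<open>auto simp: padic_int_simps(5) mod_simps algebra_simps\<close>)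
  show "Group.comm_monoid ?R"
  proof (rule comm_monoidI)
    fix x assume "x \<in> carrier ?R"
    then show "\<one>\<^bsub>?R\<^esub> \<otimes>\<^bsub>?R\<^esub> x = x"
      by (simp add: padic_int_simps(2,3) mod_simps padic_int_memD)
  qed (use mulc oc in \<open>auto simp: padic_int_simps(2) mod_simps algebra_simps\<close>)
  show "(x \<oplus>\<^bsub>?R\<^esub> y) \<otimes>\<^bsub>?R\<^esub> z = x \<otimes>\<^bsub>?R\<^esub> z \<oplus>\<^bsub>?R\<^esub> y \<otimes>\<^bsub>?R\<^esub> z" for x y z
    by (simp add: padic_int_simps(2,5) mod_simps algebra_simps)
qed

text \<open>Residue balls; the ball \<open>padic_ball p 0 1\<close> is empty.\<close>

definition padic_ball :: "nat \<Rightarrow> nat \<Rightarrow> int \<Rightarrow> (nat \<Rightarrow> int) set" where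
  "padic_ball p k r = {x \<in> carrier (padic_int p). x k = r}"

lemma padic_ball_0: "padic_ball p 0 0 = carrier (padic_int p)"
proof -
  have "x 0 = 0" if "x \<in> carrier (padic_int p)" for x
    using padic_int_memD(1,2)[OF that, of 0] by simp
  then show ?thesis by (auto simp: padic_ball_def)
qed

lemma padic_ball_empty: "r \<notin> {0..<int p ^ k} \<Longrightarrow> padic_ball p k r = {}"
  by (auto simp: padic_ball_def padic_int_simps)

lemma openin_padic_ball: "openin (padic_topology p) (padic_ball p k r)"
proof -
  have "openin (product_topology (\<lambda>_. discrete_topology UNIV) UNIV) {x :: nat \<Rightarrow> int. x k \<in> {r}}"
    using openin_continuous_map_preimage[OF continuous_map_product_projection[of k UNIV "\<lambda>_. discrete_topology (UNIV::int set)"], of "{r}"]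
    by simp
  then show ?thesis
    unfolding padic_topology_def openin_subtopology
    by (intro exI[of _ "{x :: nat \<Rightarrow> int. x k \<in> {r}}"]) (auto simp: padic_ball_def)
qed

lemma padic_open_contains_ball:
  assumes "openin (padic_topology p) U" "x \<in> U"
  shows "\<exists>k. padic_ball p k (x k) \<subseteq> U"
proof -
  obtain T where T: "openin (product_topology (\<lambda>_. discrete_topology UNIV) UNIV) T"
      and U: "U = T \<inter> carrier (padic_int p)"
    using assms(1) unfolding padic_topology_def openin_subtopology by blast
  have "x \<in> T" using U assms(2) by blast
  then obtain V where V: "finite {i. V i \<noteq> (UNIV::int set)}" "x \<in> Pi\<^sub>E UNIV V" "Pi\<^sub>E UNIV V \<subseteq> T"
    using T unfolding openin_product_topology_alt by (auto simp: Bex_def)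
  define k where "k = Max (insert 0 {i. V i \<noteq> UNIV})"
  have k: "i \<le> k" if "V i \<noteq> UNIV" for i
    using that V(1) by (auto simp: k_def)
  have "y \<in> U" if y: "y \<in> padic_ball p k (x k)" for y
  proof -
    have yc: "y \<in> carrier (padic_int p)" and "y k = x k" using y by (auto simp: padic_ball_def)
    moreover have "x \<in> carrier (padic_int p)" using U assms(2) by blast
    ultimately have "y i = x i" if "i \<le> k" for i
      using that padic_int_mod by metis
    then have "y i \<in> V i" for i
      using k[of i] V(2) by (cases "V i = UNIV") auto
    then show ?thesis using V(3) U yc by auto
  qed
  then show ?thesis by blast
qed

lemma space_padic_borel: "space (padic_borel p) = carrier (padic_int p)"
  and sets_padic_borel:
    "sets (padic_borel p) = sigma_sets (carrier (padic_int p)) (range (case_prod (padic_ball p)))"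
proof -
  let ?Z = "carrier (padic_int p)"
  let ?B = "range (case_prod (padic_ball p))"
  have "{U. openin (padic_topology p) U} \<subseteq> Pow ?Z"
    unfolding padic_topology_def using openin_subset by fastforce
  then show "space (padic_borel p) = ?Z"
    by (simp add: padic_borel_def space_measure_of)
  have "sigma_sets ?Z {U. openin (padic_topology p) U} = sigma_sets ?Z ?B"
  proof (rule sigma_sets_eqI)
    fix U assume "U \<in> {U. openin (padic_topology p) U}"
    then have U: "openin (padic_topology p) U" by simp
    define C where "C = {b. case_prod (padic_ball p) b \<subseteq> U}"
    have "U = (\<Union>b\<in>C. case_prod (padic_ball p) b)"
    proof
      show "U \<subseteq> (\<Union>b\<in>C. case_prod (padic_ball p) b)"
      proof
        fix x assume x: "x \<in> U"
        obtain k where "padic_ball p k (x k) \<subseteq> U" using padic_open_contains_ball[OF U x] ..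
        moreover have "x \<in> ?Z" using U x openin_subset unfolding padic_topology_def by fastforce
        ultimately show "x \<in> (\<Union>b\<in>C. case_prod (padic_ball p) b)"
          by (intro UN_I[of "(k, x k)"]) (auto simp: C_def padic_ball_def)
      qed
    qed (auto simp: C_def)
    moreover have "(\<Union>b\<in>C. case_prod (padic_ball p) b) \<in> sigma_sets ?Z ?B"
      by (rule sigma_sets_UNION) auto
    ultimately show "U \<in> sigma_sets ?Z ?B" by simp
  qed (auto intro!: sigma_sets.Basic openin_padic_ball)
  with \<open>_ \<subseteq> Pow ?Z\<close> show "sets (padic_borel p) = sigma_sets ?Z ?B"
    by (simp add: padic_borel_def sets_measure_of)
qed

lemma padic_ball_sets [measurable]: "padic_ball p k r \<in> sets (padic_borel p)"
  unfolding sets_padic_borel by (rule sigma_sets.Basic) (auto intro!: image_eqI[of _ _ "(k, r)"])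

lemma Int_stable_padic_ball: "Int_stable (range (case_prod (padic_ball p)))"
proof -
  have *: "padic_ball p k r \<inter> padic_ball p l s \<in> range (case_prod (padic_ball p))" if "k \<le> l" for k l r s
  proof (cases "s mod int p ^ k = r")
    case True
    then have "padic_ball p k r \<inter> padic_ball p l s = padic_ball p l s"
      using padic_int_mod[OF _ that] by (auto simp: padic_ball_def)
    then show ?thesis by (auto intro!: image_eqI[of _ _ "(l, s)"])
  next
    case False
    then have "padic_ball p k r \<inter> padic_ball p l s = {}"
      using padic_int_mod[OF _ that] by (auto simp: padic_ball_def)
    then have "padic_ball p k r \<inter> padic_ball p l s = padic_ball p 0 1"
      by (simp add: padic_ball_empty)
    then show ?thesis by (auto intro!: image_eqI[of _ _ "(0, 1)"])
  qed
  show ?thesis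
  proof (rule Int_stableI_image)
    fix a b :: "nat \<times> int"
    obtain k r l s where ab: "a = (k, r)" "b = (l, s)" by (cases a, cases b)
    show "\<exists>c\<in>UNIV. case_prod (padic_ball p) a \<inter> case_prod (padic_ball p) b = case_prod (padic_ball p) c"
      using *[of k l r s] *[of l k s r] unfolding ab
      by (cases "k \<le> l") (simp_all add: Int_commute image_iff)
  qed
qed

lemma padic_measure_eqI:
  assumes "sets M = sets (padic_borel p)" "sets N = sets (padic_borel p)"
    and M: "\<And>k r. r \<in> {0..<int p ^ k} \<Longrightarrow> emeasure M (padic_ball p k r) = 1 / of_nat (p ^ k)"
    and N: "\<And>k r. r \<in> {0..<int p ^ k} \<Longrightarrow> emeasure N (padic_ball p k r) = 1 / of_nat (p ^ k)"
  shows "M = N"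
proof (rule measure_eqI_generator_eq[OF Int_stable_padic_ball])
  show "range (case_prod (padic_ball p)) \<subseteq> Pow (carrier (padic_int p))"
    by (auto simp: padic_ball_def)
  fix V assume "V \<in> range (case_prod (padic_ball p))"
  then obtain k r where V: "V = padic_ball p k r" by auto
  show "emeasure M V = emeasure N V"
    unfolding V using M[of r k] N[of r k] padic_ball_empty[of r p k]
    by (cases "r \<in> {0..<int p ^ k}") auto
next
  show "range (\<lambda>_::nat. carrier (padic_int p)) \<subseteq> range (case_prod (padic_ball p))"
    by (auto intro!: image_eqI[of _ _ "(0, 0)"] simp: padic_ball_0)
  show "emeasure M (carrier (padic_int p)) \<noteq> \<infinity>" for i :: nat
    using M[of 0 0] by (simp add: padic_ball_0)
qed (use assms in \<open>auto simp: sets_padic_borel\<close>)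

lemma padic_ball_translate:
  assumes p: "p > 0" and a: "a \<in> carrier (padic_int p)" and r: "r \<in> {0..<int p ^ k}"
  shows "(\<lambda>x. a \<oplus>\<^bsub>padic_int p\<^esub> x) ` padic_ball p k r = padic_ball p k ((a k + r) mod int p ^ k)"
proof -
  interpret cring "padic_int p" by (rule cring_padic_int[OF p])
  show ?thesis
  proof
    show "(\<lambda>x. a \<oplus>\<^bsub>padic_int p\<^esub> x) ` padic_ball p k r \<subseteq> padic_ball p k ((a k + r) mod int p ^ k)"
      using a add.m_closed by (auto simp: padic_ball_def) (simp add: padic_int_simps)
    show "padic_ball p k ((a k + r) mod int p ^ k) \<subseteq> (\<lambda>x. a \<oplus>\<^bsub>padic_int p\<^esub> x) ` padic_ball p k r"
    proof
      fix y assume "y \<in> padic_ball p k ((a k + r) mod int p ^ k)"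
      then have y: "y \<in> carrier (padic_int p)" "y k = (a k + r) mod int p ^ k"
        by (auto simp: padic_ball_def)
      define x where "x = \<ominus>\<^bsub>padic_int p\<^esub> a \<oplus>\<^bsub>padic_int p\<^esub> y"
      have x: "x \<in> carrier (padic_int p)" "a \<oplus>\<^bsub>padic_int p\<^esub> x = y"
        using a y by (simp_all add: x_def r_neg2)
      have "(a k + x k) mod int p ^ k = (a k + r) mod int p ^ k"
        using x(2) y(2) by (auto simp: padic_int_simps(5))
      then have "x k mod int p ^ k = r mod int p ^ k"
        by (metis add_diff_cancel_left' mod_diff_left_eq)
      then have "x k = r" using x(1) r by (simp add: padic_int_memD)
      then show "y \<in> (\<lambda>x. a \<oplus>\<^bsub>padic_int p\<^esub> x) ` padic_ball p k r"
        using x by (auto simp: padic_ball_def)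
    qed
  qed
qed

lemma padic_haar_ball:
  assumes p: "p > 0" and M: "is_padic_haar p M" and r: "r \<in> {0..<int p ^ k}"
  shows "emeasure M (padic_ball p k r) = 1 / of_nat (p ^ k)"
proof -
  have sets: "padic_ball p k s \<in> sets M" for s
    using M by (simp add: is_padic_haar_def)
  have eq: "emeasure M (padic_ball p k s) = emeasure M (padic_ball p k 0)" if s: "s \<in> {0..<int p ^ k}" for s
  proof -
    define a where "a = (\<lambda>k. s mod int p ^ k)"
    have a: "a \<in> carrier (padic_int p)"
      unfolding a_def by (rule padic_int_closed[OF p]) simp
    have "a k = s" using s by (simp add: a_def)
    then have "(\<lambda>x. a \<oplus>\<^bsub>padic_int p\<^esub> x) ` padic_ball p k 0 = padic_ball p k s"
      using padic_ball_translate[OF p a, of 0 k] s p by simp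
    then show ?thesis
      using M a sets[of 0] by (metis is_padic_haar_def)
  qed
  have "1 = emeasure M (\<Union>s\<in>{0..<int p ^ k}. padic_ball p k s)"
  proof -
    have "carrier (padic_int p) = (\<Union>s\<in>{0..<int p ^ k}. padic_ball p k s)"
      by (auto simp: padic_ball_def padic_int_simps)
    then show ?thesis using M by (simp add: is_padic_haar_def)
  qed
  also have "\<dots> = (\<Sum>s\<in>{0..<int p ^ k}. emeasure M (padic_ball p k s))"
    using sets by (intro sum_emeasure[symmetric]) (auto simp: disjoint_family_on_def padic_ball_def)
  also have "\<dots> = (\<Sum>s\<in>{0..<int p ^ k}. emeasure M (padic_ball p k r))"
    using eq r by (intro sum.cong) auto
  also have "\<dots> = of_nat (p ^ k) * emeasure M (padic_ball p k r)"
    by (simp add: nat_power_eq)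
  finally have "1 = emeasure M (padic_ball p k r) * of_nat (p ^ k)" by (simp add: mult.commute)
  moreover have "(of_nat (p ^ k) :: ennreal) \<noteq> 0" "(of_nat (p ^ k) :: ennreal) \<noteq> \<top>" using p by (simp_all del: of_nat_power)
  ultimately show ?thesis
    by (metis ennreal_mult_divide_eq)
qed

lemma padic_haar_exists:
  assumes p: "p > 0"
  shows "\<exists>M. is_padic_haar p M"
proof -
  define D where "D = {0..<int p}"
  define P where "P = Pi\<^sub>M (UNIV :: nat set) (\<lambda>_. uniform_count_measure D)"
  define g where "g d k = (\<Sum>i<k. d i * int p ^ i)" for d :: "nat \<Rightarrow> int" and k
  have D: "finite D" "D \<noteq> {}" "card D = p" using p by (auto simp: D_def)
  interpret U: prob_space "uniform_count_measure D"
    by (rule prob_space_uniform_count_measure) (use D in auto)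
  interpret product_prob_space "\<lambda>_. uniform_count_measure D" "UNIV :: nat set" ..
  have spP: "space P = {d. \<forall>i. d i \<in> D}"
    by (auto simp: P_def space_PiM space_uniform_count_measure PiE_UNIV_domain)
  have bound: "g d k \<in> {0..<int p ^ k}" if "d \<in> space P" for d k
  proof (induction k)
    case (Suc k)
    have "d k \<le> int p - 1" "0 \<le> d k" using that by (auto simp: spP D_def)
    then have "d k * int p ^ k \<le> (int p - 1) * int p ^ k" "0 \<le> d k * int p ^ k"
      by (auto intro: mult_right_mono)
    then show ?case using Suc by (auto simp: g_def algebra_simps)
  qed (simp add: g_def)
  have gc: "g d \<in> carrier (padic_int p)" if "d \<in> space P" for d
    using bound[OF that] by (auto simp: padic_int_simps g_def)
  have ball: "\<exists>e. (\<forall>i. e i \<in> D) \<and> {d \<in> space P. g d k = r} = {d \<in> space P. \<forall>i\<in>{..<k}. d i \<in> {e i}}"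
    if "r \<in> {0..<int p ^ k}" for k r
    using that
  proof (induction k arbitrary: r)
    case 0
    then show ?case using D(2) by (auto simp: g_def)
  next
    case (Suc k)
    define s where "s = r mod int p ^ k"
    define q where "q = r div int p ^ k"
    have r: "r = s + q * int p ^ k" unfolding s_def q_def by (metis add.commute div_mult_mod_eq)
    have s: "s \<in> {0..<int p ^ k}" using p by (simp add: s_def)
    have "r < int p * int p ^ k" using Suc by simp
    moreover have "q * int p ^ k \<le> r" using s r by simp
    ultimately have "q * int p ^ k < int p * int p ^ k" by linarith
    then have "q < int p" by (simp add: mult_less_cancel_right)
    moreover have "0 \<le> q" using Suc.prems p by (simp add: q_def pos_imp_zdiv_nonneg_iff)
    ultimately have q: "q \<in> D" by (simp add: D_def)
    obtain e where e: "\<forall>i. e i \<in> D" "{d \<in> space P. g d k = s} = {d \<in> space P. \<forall>i\<in>{..<k}. d i \<in> {e i}}"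
      using Suc.IH[OF s] by blast
    have iff: "g d (Suc k) = r \<longleftrightarrow> g d k = s \<and> d k = q" if d: "d \<in> space P" for d
    proof
      assume h: "g d (Suc k) = r"
      then have h': "g d k + d k * int p ^ k = s + q * int p ^ k" using r by (simp add: g_def)
      have "g d k = (g d k + d k * int p ^ k) mod int p ^ k" using bound[OF d, of k] by simp
      also have "\<dots> = s" using h' s by simp
      finally show "g d k = s \<and> d k = q" using h' p by simp
    qed (simp add: g_def r)
    have "{d \<in> space P. g d (Suc k) = r} = {d \<in> space P. g d k = s} \<inter> {d. d k = q}"
      using iff by auto
    also have "\<dots> = {d \<in> space P. \<forall>i\<in>{..<Suc k}. d i \<in> {(e(k := q)) i}}"
      unfolding e(2) by (auto simp: less_Suc_eq)
    finally show ?case using e(1) q by (intro exI[of _ "e(k := q)"]) auto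
  qed
  have em: "emeasure P {d \<in> space P. g d k = r} = 1 / of_nat (p ^ k)"
    and ms: "{d \<in> space P. g d k = r} \<in> sets P"
    if r: "r \<in> {0..<int p ^ k}" for k r
  proof -
    obtain e where e: "\<forall>i. e i \<in> D" "{d \<in> space P. g d k = r} = {d \<in> space P. \<forall>i\<in>{..<k}. d i \<in> {e i}}"
      using ball[OF r] by blast
    have [measurable]: "{e i} \<in> sets (uniform_count_measure D)" for i
      using e(1) by (simp add: sets_uniform_count_measure)
    show "{d \<in> space P. g d k = r} \<in> sets P" unfolding e(2) unfolding P_def by measurable
    have "emeasure P {d \<in> space P. g d k = r} = (\<Prod>i<k. emeasure (uniform_count_measure D) {e i})"
      unfolding e(2) unfolding P_def by (subst emeasure_PiM_Collect) auto
    also have "\<dots> = (\<Prod>i<k. ennreal (1 / real p))"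
      using e(1) D by (intro prod.cong) (auto simp: emeasure_uniform_count_measure)
    also have "\<dots> = ennreal ((1 / real p) ^ k)" by (simp add: ennreal_power)
    also have "\<dots> = 1 / of_nat (p ^ k)"
      using p by (simp add: power_divide ennreal_of_nat_eq_real_of_nat flip: divide_ennreal ennreal_1)
    finally show "emeasure P {d \<in> space P. g d k = r} = 1 / of_nat (p ^ k)" .
  qed
  have gm: "g \<in> measurable P (padic_borel p)"
  proof (rule measurable_sigma_sets[OF sets_padic_borel])
    show "range (case_prod (padic_ball p)) \<subseteq> Pow (carrier (padic_int p))"
      by (auto simp: padic_ball_def)
    show "g \<in> space P \<rightarrow> carrier (padic_int p)" using gc by auto
    fix V assume "V \<in> range (case_prod (padic_ball p))"
    then obtain k r where V: "V = padic_ball p k r" by auto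
    show "g -` V \<inter> space P \<in> sets P"
    proof (cases "r \<in> {0..<int p ^ k}")
      case True
      have "g -` V \<inter> space P = {d \<in> space P. g d k = r}"
        using gc by (auto simp: V padic_ball_def)
      then show ?thesis using ms[OF True] by simp
    qed (simp add: V padic_ball_empty)
  qed
  define M where "M = distr P (padic_borel p) g"
  have setsM: "sets M = sets (padic_borel p)" by (simp add: M_def)
  have Mball: "emeasure M (padic_ball p k r) = 1 / of_nat (p ^ k)" if r: "r \<in> {0..<int p ^ k}" for k r
  proof -
    have "emeasure M (padic_ball p k r) = emeasure P (g -` padic_ball p k r \<inter> space P)"
      unfolding M_def by (rule emeasure_distr[OF gm]) simp
    also have "g -` padic_ball p k r \<inter> space P = {d \<in> space P. g d k = r}"
      using gc by (auto simp: padic_ball_def)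
    finally show ?thesis using em[OF r] by simp
  qed
  interpret R: cring "padic_int p" by (rule cring_padic_int[OF p])
  have "is_padic_haar p M"
    unfolding is_padic_haar_def
  proof (intro conjI ballI)
    show "emeasure M (carrier (padic_int p)) = 1"
      using Mball[of 0 0] by (simp add: padic_ball_0)
    fix a A assume a: "a \<in> carrier (padic_int p)" and A: "A \<in> sets M"
    define T where "T x = (\<ominus>\<^bsub>padic_int p\<^esub> a) \<oplus>\<^bsub>padic_int p\<^esub> x" for x
    have im: "(\<lambda>x. a \<oplus>\<^bsub>padic_int p\<^esub> x) ` V = T -` V \<inter> carrier (padic_int p)"
      if "V \<subseteq> carrier (padic_int p)" for V
    proof
      show "(\<lambda>x. a \<oplus>\<^bsub>padic_int p\<^esub> x) ` V \<subseteq> T -` V \<inter> carrier (padic_int p)"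
        using that a by (auto simp: T_def R.r_neg1 subset_iff)
      show "T -` V \<inter> carrier (padic_int p) \<subseteq> (\<lambda>x. a \<oplus>\<^bsub>padic_int p\<^esub> x) ` V"
        using a by (auto intro!: image_eqI[of _ _ "T _"] simp: T_def R.r_neg2)
    qed
    have spM: "space M = carrier (padic_int p)" by (simp add: M_def space_padic_borel)
    have preball: "T -` padic_ball p k r \<inter> carrier (padic_int p) = padic_ball p k ((a k + r) mod int p ^ k)"
      if "r \<in> {0..<int p ^ k}" for k r
      using padic_ball_translate[OF p a that] im[of "padic_ball p k r"]
      by (auto simp: padic_ball_def)
    have Tm: "T \<in> measurable M (padic_borel p)"
    proof (rule measurable_sigma_sets[OF sets_padic_borel])
      show "range (case_prod (padic_ball p)) \<subseteq> Pow (carrier (padic_int p))"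
        by (auto simp: padic_ball_def)
      show "T \<in> space M \<rightarrow> carrier (padic_int p)" using a by (auto simp: T_def spM)
      fix V assume "V \<in> range (case_prod (padic_ball p))"
      then obtain k r where V: "V = padic_ball p k r" by auto
      show "T -` V \<inter> space M \<in> sets M"
        using preball[of r k] by (cases "r \<in> {0..<int p ^ k}") (auto simp: V spM setsM padic_ball_empty)
    qed
    have eq: "distr M (padic_borel p) T = M"
    proof (rule padic_measure_eqI)
      fix k r assume r: "r \<in> {0..<int p ^ k}"
      have "emeasure (distr M (padic_borel p) T) (padic_ball p k r) = emeasure M (T -` padic_ball p k r \<inter> space M)"
        by (rule emeasure_distr[OF Tm]) simp
      also have "\<dots> = 1 / of_nat (p ^ k)"
        using p by (simp only: spM preball[OF r]) (intro Mball, simp)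
      finally show "emeasure (distr M (padic_borel p) T) (padic_ball p k r) = 1 / of_nat (p ^ k)" .
    qed (use setsM Mball in auto)
    have "A \<subseteq> carrier (padic_int p)" using sets.sets_into_space[OF A] spM by simp
    then have "emeasure M ((\<lambda>x. a \<oplus>\<^bsub>padic_int p\<^esub> x) ` A) = emeasure M (T -` A \<inter> space M)"
      using im spM by simp
    also have "\<dots> = emeasure (distr M (padic_borel p) T) A"
      using A setsM by (intro emeasure_distr[OF Tm, symmetric]) simp
    finally show "emeasure M ((\<lambda>x. a \<oplus>\<^bsub>padic_int p\<^esub> x) ` A) = emeasure M A" by (simp add: eq)
  qed (rule setsM)
  then show ?thesis ..
qed

theorem padic_haar_unique:
  assumes "p > 0"
  shows "\<exists>!M. is_padic_haar p M"
proof (rule ex_ex1I)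
  show "\<exists>M. is_padic_haar p M" by (rule padic_haar_exists[OF assms])
  fix M N assume "is_padic_haar p M" "is_padic_haar p N"
  then show "M = N"
    using padic_haar_ball[OF assms] by (intro padic_measure_eqI) (auto simp: is_padic_haar_def)
qed

lemma is_padic_haar_padic_haar: "p > 0 \<Longrightarrow> is_padic_haar p (padic_haar p)"
  unfolding padic_haar_def by (rule theI') (rule padic_haar_unique)

lemma qf_eval_type:
  fixes x :: "nat \<Rightarrow> 'a :: comm_ring_1"
  shows "qf_eval ring_of_type_algebra n c x = (\<Sum>j<n. \<Sum>i\<le>j. of_int (c i j) * (x i * x j))"
proof -
  let ?R = "ring_of_type_algebra :: 'a ring"
  interpret cring ?R by (rule cring_from_type_algebra)
  have R: "carrier ?R = UNIV" "\<zero>\<^bsub>?R\<^esub> = 0" "\<And>a b. a \<oplus>\<^bsub>?R\<^esub> b = a + b" "\<And>a b. a \<otimes>\<^bsub>?R\<^esub> b = a * b"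
    by (simp_all add: ring_of_type_algebra_def)
  have fs: "finsum ?R f A = sum f A" if "finite A" for f :: "nat \<Rightarrow> 'a" and A
    using that by (induction A rule: finite_induct) (auto simp: R finsum_insert Pi_def)
  have np: "[n] \<cdot>\<^bsub>?R\<^esub> a = of_nat n * a" for n :: nat and a
  proof (induction n)
    case 0
    have "add_pow ?R (0::nat) a = \<zero>\<^bsub>?R\<^esub>" by (rule add.nat_pow_0)
    then show ?case by (simp only: R of_nat_0 mult_zero_left)
  next
    case (Suc n)
    have "[Suc n] \<cdot>\<^bsub>?R\<^esub> a = [n] \<cdot>\<^bsub>?R\<^esub> a \<oplus>\<^bsub>?R\<^esub> a" by (rule add.nat_pow_Suc)
    then show ?case by (simp only: Suc R of_nat_Suc distrib_right mult_1_left add.commute)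
  qed
  have neg: "\<ominus>\<^bsub>?R\<^esub> a = - a" for a
    using minus_equality[of "- a" a] by (simp add: R)
  have ip: "[k] \<cdot>\<^bsub>?R\<^esub> a = of_int k * a" for k :: int and a
  proof (cases "k < 0")
    case True
    then have "[k] \<cdot>\<^bsub>?R\<^esub> a = \<ominus>\<^bsub>?R\<^esub> ([nat (- k)] \<cdot>\<^bsub>?R\<^esub> a)"
      unfolding add_pow_def int_pow_def2 a_inv_def by simp
    then show ?thesis using True by (simp add: np neg)
  next
    case False
    then have "[k] \<cdot>\<^bsub>?R\<^esub> a = [nat k] \<cdot>\<^bsub>?R\<^esub> a"
      unfolding add_pow_def int_pow_def2 by simp
    then show ?thesis using False by (simp add: np)
  qed
  show ?thesis by (simp add: qf_eval_def fs ip R)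
qed

end

theory Submission
  imports Defs "HOL-Number_Theory.Cong"
begin

text \<open>
  The only property of the local value sets \<open>V\<^sub>p = f(\<int>\<^sub>p\<^sup>n)\<close> that matters is that they, and hence their
  complements, are stable under multiplication by squares of units. By Hensel's lemma, membership in
  \<open>V\<^sub>p\<close> outside \<open>p\<^sup>k \<int>\<^sub>p\<close> is then a congruence condition modulo \<open>p\<^sup>k\<^sup>+\<^sup>3\<close>, so the Chinese remainder theorem
  gives the density for finitely many primes.

  For odd \<open>p\<close>, either \<open>V\<^sub>p\<close> misses a unit, and then a positive proportion of all units, so that
  \<open>\<delta>\<^sub>p \<le> 2/3\<close>; or it contains all units but misses an element of valuation 1, so that
  \<open>\<delta>\<^sub>p \<le> 1 - 1/(3p)\<close> while only multiples of \<open>p\<close> fail to be represented; or it is everything. If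
  \<open>\<Prod>\<delta>\<^sub>p\<close> is positive, the first case is therefore rare and the sum of \<open>1/p\<close> over the second case
  converges, which makes the union bound over all large primes small. If the product is zero, the upper
  bound from finitely many primes already suffices.
\<close>

section \<open>Densities of periodic sets of integers\<close>

definition mod_periodic :: "nat \<Rightarrow> int set \<Rightarrow> bool" where
  "mod_periodic m A \<longleftrightarrow> (\<forall>x. x mod int m \<in> A \<longleftrightarrow> x \<in> A)"

text \<open>One-sided density; negative integers are treated by passing to the preimage of the set
  under \<open>uminus\<close>.\<close>

definition has_pos_density :: "int set \<Rightarrow> real \<Rightarrow> bool" where
  "has_pos_density S d \<longleftrightarrow> (\<lambda>N::nat. real (card (S \<inter> {1..int N})) / real N) \<longlonglongrightarrow> d"

text \<open>Reduction modulo \<open>m\<close> maps any \<open>m\<close> consecutive integers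
  bijectively onto \<open>{0..<int m}\<close>, with inverse
  \<open>\<lambda>r. a + (r - a) mod int m\<close>; periodicity makes both maps respect
  \<open>A\<close>.\<close>

lemma card_mod_periodic_window:
  assumes "m > 0" "mod_periodic m A"
  shows "card (A \<inter> {a..<a + int m}) = card (A \<inter> {0..<int m})"
proof (rule bij_betw_same_card, rule bij_betw_byWitness[where f' = "\<lambda>r. a + (r - a) mod int m"])
  show "\<forall>x\<in>A \<inter> {a..<a + int m}. a + (x mod int m - a) mod int m = x"
    by (auto simp: mod_simps)
  show "\<forall>r\<in>A \<inter> {0..<int m}. (a + (r - a) mod int m) mod int m = r"
    by (auto simp: mod_simps)
  show "(\<lambda>x. x mod int m) ` (A \<inter> {a..<a + int m}) \<subseteq> A \<inter> {0..<int m}"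
    using assms by (auto simp: mod_periodic_def)
  have "a + (r - a) mod int m \<in> A" if "r \<in> A" for r
  proof -
    have "(a + (r - a) mod int m) mod int m = r mod int m" by (simp add: mod_simps)
    then show ?thesis using that assms(2) unfolding mod_periodic_def by metis
  qed
  then show "(\<lambda>r. a + (r - a) mod int m) ` (A \<inter> {0..<int m}) \<subseteq> A \<inter> {a..<a + int m}"
    using assms by auto
qed

text \<open>Negation maps \<open>{0..<int m}\<close> onto the window starting at
  \<open>1 - int m\<close>, and all windows have the same count.\<close>

lemma card_mod_periodic_uminus:
  assumes "m > 0" "mod_periodic m A"
  shows "card (uminus -` A \<inter> {0..<int m}) = card (A \<inter> {0..<int m})"
proof -
  have "uminus ` (uminus -` A \<inter> {0..<int m}) = A \<inter> {1 - int m..<1 - int m + int m}"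
    by (auto intro!: image_eqI[of _ _ "- _"])
  then have "card (uminus -` A \<inter> {0..<int m}) = card (A \<inter> {1 - int m..<1 - int m + int m})"
    by (metis card_image inj_on_def neg_equal_iff_equal)
  then show ?thesis using card_mod_periodic_window[OF assms, of "1 - int m"] by simp
qed

lemma mod_periodic_uminus:
  assumes "mod_periodic m A"
  shows "mod_periodic m (uminus -` A)"
  using assms unfolding mod_periodic_def by (metis mod_minus_eq vimage_eq)

lemma mod_periodic_inter:
  assumes "mod_periodic m A" "mod_periodic n B"
  shows "mod_periodic (m * n) (A \<inter> B)"
proof -
  have "x mod int (m * n) \<in> A \<longleftrightarrow> x \<in> A" for x
    using assms(1) unfolding mod_periodic_def by (metis dvd_triv_left mod_mod_cancel of_nat_mult)
  moreover have "x mod int (m * n) \<in> B \<longleftrightarrow> x \<in> B" for x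
    using assms(2) unfolding mod_periodic_def by (metis dvd_triv_right mod_mod_cancel of_nat_mult)
  ultimately show ?thesis by (simp add: mod_periodic_def)
qed

text \<open>Chinese remainder theorem: the two residues determine an integer modulo
  \<open>m * n\<close>, and membership in \<open>A\<close> and in \<open>B\<close> each depends on
  only one of them.\<close>

lemma card_mod_periodic_inter:
  assumes A: "mod_periodic m A" and B: "mod_periodic n B"
    and pos: "m > 0" "n > 0" and cop: "coprime m n"
  shows "card (A \<inter> B \<inter> {0..<int (m * n)})
    = card (A \<inter> {0..<int m}) * card (B \<inter> {0..<int n})"
proof -
  have cop': "coprime (int m) (int n)" using cop by simp
  have "bij_betw (\<lambda>x. (x mod int m, x mod int n)) (A \<inter> B \<inter> {0..<int (m * n)})
    ((A \<inter> {0..<int m}) \<times> (B \<inter> {0..<int n}))"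
    unfolding bij_betw_def
  proof
    show "inj_on (\<lambda>x. (x mod int m, x mod int n)) (A \<inter> B \<inter> {0..<int (m * n)})"
    proof (rule inj_onI)
      fix x y assume xy: "x \<in> A \<inter> B \<inter> {0..<int (m * n)}" "y \<in> A \<inter> B \<inter> {0..<int (m * n)}"
        and eq: "(x mod int m, x mod int n) = (y mod int m, y mod int n)"
      have "[x = y] (mod (int m * int n))"
        using eq cop' by (intro coprime_cong_mult) (auto simp: cong_def)
      then show "x = y" using xy by (simp add: cong_def)
    qed
    show "(\<lambda>x. (x mod int m, x mod int n)) ` (A \<inter> B \<inter> {0..<int (m * n)})
      = (A \<inter> {0..<int m}) \<times> (B \<inter> {0..<int n})"
    proof
      show "(\<lambda>x. (x mod int m, x mod int n)) ` (A \<inter> B \<inter> {0..<int (m * n)})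
        \<subseteq> (A \<inter> {0..<int m}) \<times> (B \<inter> {0..<int n})"
        using A B pos by (auto simp: mod_periodic_def)
      show "(A \<inter> {0..<int m}) \<times> (B \<inter> {0..<int n})
        \<subseteq> (\<lambda>x. (x mod int m, x mod int n)) ` (A \<inter> B \<inter> {0..<int (m * n)})"
      proof clarify
        fix a b assume a: "a \<in> A" "a \<in> {0..<int m}" and b: "b \<in> B" "b \<in> {0..<int n}"
        obtain z where z: "[z = a] (mod int m)" "[z = b] (mod int n)"
          using binary_chinese_remainder_int[OF cop'] by blast
        define x where "x = z mod int (m * n)"
        have x: "x mod int m = a" "x mod int n = b"
          using z a b by (simp_all add: x_def cong_def mod_mod_cancel)
        then have "x \<in> A" "x \<in> B" using a b A B by (metis mod_periodic_def)+
        moreover have "x \<in> {0..<int (m * n)}" using pos by (simp add: x_def)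
        ultimately show "(a, b) \<in> (\<lambda>x. (x mod int m, x mod int n)) ` (A \<inter> B \<inter> {0..<int (m * n)})"
          using x by (intro image_eqI[of _ _ x]) auto
      qed
    qed
  qed
  then show ?thesis by (simp add: bij_betw_same_card card_cartesian_product)
qed

text \<open>Both conclusions go through one induction, because the count for
  \<open>insert q P\<close> uses periodicity of the intersection over \<open>P\<close>.\<close>

lemma mod_periodic_INT:
  assumes "finite P" "\<And>p. p \<in> P \<Longrightarrow> m p > 0" "\<And>p. p \<in> P \<Longrightarrow> mod_periodic (m p) (A p)"
    and "\<And>p q. p \<in> P \<Longrightarrow> q \<in> P \<Longrightarrow> p \<noteq> q \<Longrightarrow> coprime (m p) (m q)"
  shows "mod_periodic (\<Prod>p\<in>P. m p) (\<Inter>p\<in>P. A p) \<and>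
    card ((\<Inter>p\<in>P. A p) \<inter> {0..<int (\<Prod>p\<in>P. m p)}) = (\<Prod>p\<in>P. card (A p \<inter> {0..<int (m p)}))"
  using assms
proof (induction P rule: finite_induct)
  case empty
  have "{0..<1} = {0::int}" by auto
  then show ?case by (simp add: mod_periodic_def)
next
  case (insert q P)
  have cop: "coprime (m q) (\<Prod>p\<in>P. m p)"
    using insert by (intro prod_coprime_right) auto
  have pos: "m q > 0" "(\<Prod>p\<in>P. m p) > 0"
    using insert by (auto intro!: prod_pos)
  have IH: "mod_periodic (\<Prod>p\<in>P. m p) (\<Inter>p\<in>P. A p)"
    "card ((\<Inter>p\<in>P. A p) \<inter> {0..<int (\<Prod>p\<in>P. m p)}) = (\<Prod>p\<in>P. card (A p \<inter> {0..<int (m p)}))"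
    using insert by blast+
  have q: "mod_periodic (m q) (A q)" using insert by blast
  have *: "(\<Prod>p\<in>insert q P. m p) = m q * (\<Prod>p\<in>P. m p)"
    "(\<Inter>p\<in>insert q P. A p) = A q \<inter> (\<Inter>p\<in>P. A p)"
    "(\<Prod>p\<in>insert q P. card (A p \<inter> {0..<int (m p)}))
      = card (A q \<inter> {0..<int (m q)}) * (\<Prod>p\<in>P. card (A p \<inter> {0..<int (m p)}))"
    using insert by auto
  show ?case
    unfolding * card_mod_periodic_inter[OF q IH(1) pos cop] IH(2)
    using mod_periodic_inter[OF q IH(1)] by simp
qed

lemma mod_periodic_density:
  assumes m: "m > 0" and A: "mod_periodic m A"
  shows "has_pos_density A (card (A \<inter> {0..<int m}) / m)"
proof -
  define c where "c = card (A \<inter> {0..<int m})"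
  have full: "card (A \<inter> {1..<1 + int (q * m)}) = q * c" for q
  proof (induction q)
    case (Suc q)
    have "{1..<1 + int (Suc q * m)} = {1..<1 + int (q * m)} \<union> {1 + int (q * m)..<1 + int (q * m) + int m}"
      by (subst ivl_disj_un_two) auto
    then have "A \<inter> {1..<1 + int (Suc q * m)}
      = (A \<inter> {1..<1 + int (q * m)}) \<union> (A \<inter> {1 + int (q * m)..<1 + int (q * m) + int m})"
      by blast
    also have "card \<dots> = q * c + c"
      unfolding c_def using Suc card_mod_periodic_window[OF m A, of "1 + int (q * m)"]
      by (subst card_Un_disjoint) (auto simp: c_def simp del: of_nat_mult)
    finally show ?case by simp
  qed simp
  \<comment> \<open>For \<open>q * m \<le> N < Suc q * m\<close> both the count and
    \<open>N * c / m\<close> lie between \<open>q * c\<close> and \<open>Suc q * c\<close>, so they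
    differ by at most \<open>c\<close>.\<close>
  have bound: "\<bar>real (card (A \<inter> {1..int N})) / N - c / m\<bar> \<le> real c * (1 / N)" if "N > 0" for N :: nat
  proof -
    define q where "q = N div m"
    define a where "a = card (A \<inter> {1..int N})"
    have q: "q * m \<le> N" "N < Suc q * m"
      using m by (simp_all add: q_def dividend_less_div_times)
    then have q': "int (q * m) \<le> int N" "int N < int (Suc q * m)" by (simp_all only: of_nat_le_iff of_nat_less_iff)
    have "card (A \<inter> {1..<1 + int (q * m)}) \<le> a" unfolding a_def
      using q' by (intro card_mono) (auto simp del: of_nat_mult)
    moreover have "a \<le> card (A \<inter> {1..<1 + int (Suc q * m)})" unfolding a_def
      using q' by (intro card_mono) (auto simp del: of_nat_mult)
    ultimately have *: "q * c \<le> a" "a \<le> Suc q * c" using full[of q] full[of "Suc q"] by simp_all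
    then have "q * c * m \<le> a * m" "a * m \<le> Suc q * c * m" by (auto intro: mult_right_mono simp del: mult_Suc)
    moreover have "q * m * c \<le> N * c" "N * c \<le> Suc q * m * c" using q by (auto intro: mult_right_mono less_imp_le)
    moreover have "q * c * m = q * m * c" "Suc q * c * m = q * m * c + m * c" "Suc q * m * c = q * m * c + m * c"
      by (simp_all add: algebra_simps)
    ultimately have "a * m \<le> N * c + m * c" "N * c \<le> a * m + m * c" by linarith+
    then have "real (a * m) \<le> real (N * c + m * c)" "real (N * c) \<le> real (a * m + m * c)"
      by (metis of_nat_le_iff)+
    then have "\<bar>real a * real m - real N * real c\<bar> \<le> real m * real c"
      by (simp add: abs_le_iff algebra_simps)
    then have "\<bar>real a * real m - real N * real c\<bar> / (real N * real m) \<le> real m * real c / (real N * real m)"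
      by (rule divide_right_mono) simp
    moreover have "real a / real N - real c / real m = (real a * real m - real N * real c) / (real N * real m)"
      using that m by (simp add: field_simps)
    ultimately have "\<bar>real a / real N - real c / real m\<bar> \<le> real m * real c / (real N * real m)"
      by simp
    also have "\<dots> = real c * (1 / N)" using m by simp
    finally show ?thesis by (simp add: a_def)
  qed
  have "(\<lambda>N. real c * (1 / real N)) \<longlonglongrightarrow> real c * 0"
    by (intro tendsto_intros lim_1_over_n)
  then have z: "(\<lambda>N. real c * (1 / real N)) \<longlonglongrightarrow> 0" by simp
  have "(\<lambda>N. real (card (A \<inter> {1..int N})) / real N - c / m) \<longlonglongrightarrow> 0"
    by (rule Lim_null_comparison[OF _ z])
       (use bound in \<open>auto intro!: eventually_sequentiallyI[of 1]\<close>)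
  then show ?thesis unfolding has_pos_density_def c_def by (subst LIM_zero_iff[symmetric])
qed

text \<open>The bound holds for every \<open>N\<close>, not just in the limit; the union bound over
  infinitely many primes relies on this uniformity.\<close>

lemma card_multiples_le:
  assumes "q > 0"
  shows "real (card ({m::int. int q dvd m} \<inter> {1..int N})) \<le> real N / q"
proof -
  have "{m::int. int q dvd m} \<inter> {1..int N} \<subseteq> (\<lambda>i. int q * int i) ` {1..N div q}"
  proof clarify
    fix m :: int assume "int q dvd m" and m: "m \<in> {1..int N}"
    then obtain i where i: "m = int q * i" by (elim dvdE)
    have "0 < int q * i" using i m by simp
    then have "i > 0" using assms by (simp add: zero_less_mult_iff)
    then obtain j where j: "i = int j" "j > 0" using pos_int_cases by blast
    have "q * j \<le> N" using m i j by (metis atLeastAtMost_iff of_nat_le_iff of_nat_mult)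
    then have "j \<le> N div q" using assms by (simp add: less_eq_div_iff_mult_less_eq mult.commute)
    then show "m \<in> (\<lambda>i. int q * int i) ` {1..N div q}" using i j by auto
  qed
  then have "card ({m::int. int q dvd m} \<inter> {1..int N}) \<le> N div q"
    by (metis surj_card_le card_atLeastAtMost diff_Suc_1 finite_atLeastAtMost)
  then have "real (card ({m::int. int q dvd m} \<inter> {1..int N})) \<le> real (N div q)" by simp
  also have "\<dots> \<le> real N / q" by (rule of_nat_div_le_of_nat)
  finally show ?thesis .
qed


section \<open>Intersections over all primes\<close>

text \<open>Abstracts what the sieve over primes needs: \<open>W p\<close> stands for the integers
  represented over the p-adic integers, \<open>d p\<close> for the measure of the value set.
  Multiples of \<open>p ^ k\<close> are removed because membership p-adically close to 0 need not be
  decided modulo a fixed power; the error \<open>1 / real p ^ k\<close> is the measure of the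
  removed ball.\<close>

locale local_densities =
  fixes W :: "nat \<Rightarrow> int set" and d :: "nat \<Rightarrow> real"
  assumes periodic: "prime p \<Longrightarrow> mod_periodic (p ^ (k + 3)) (W p - {m. int (p ^ k) dvd m})"
    and approx: "prime p \<Longrightarrow>
      \<bar>card ((W p - {m. int (p ^ k) dvd m}) \<inter> {0..<int (p ^ (k + 3))}) / real p ^ (k + 3) - d p\<bar> \<le> 1 / real p ^ k"
    and nonneg: "prime p \<Longrightarrow> 0 \<le> d p"
    and le_one: "prime p \<Longrightarrow> d p \<le> 1"
    and defect: "prime p \<Longrightarrow> p \<noteq> 2 \<Longrightarrow>
      d p \<le> 2 / 3 \<or> (\<forall>m. \<not> int p dvd m \<longrightarrow> m \<in> W p) \<and> d p \<le> 1 - 1 / (3 * real p) \<or> W p = UNIV"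
begin

text \<open>All axioms are symmetric under negation, so the negative integers can be handled by the
  same theorem with the same \<open>d\<close>.\<close>

lemma reflect: "local_densities (\<lambda>p. uminus -` W p) d"
proof
  fix p k :: nat assume p: "prime p"
  have eq: "uminus -` W p - {m. int (p ^ k) dvd m} = uminus -` (W p - {m. int (p ^ k) dvd m})"
    by auto
  show "mod_periodic (p ^ (k + 3)) (uminus -` W p - {m. int (p ^ k) dvd m})"
    unfolding eq by (rule mod_periodic_uminus[OF periodic[OF p]])
  show "\<bar>card ((uminus -` W p - {m. int (p ^ k) dvd m}) \<inter> {0..<int (p ^ (k + 3))}) / real p ^ (k + 3) - d p\<bar>
      \<le> 1 / real p ^ k"
    unfolding eq using approx[OF p, of k] card_mod_periodic_uminus[OF _ periodic[OF p, of k]] p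
    by (simp add: prime_gt_0_nat)
  show "d p \<le> 2 / 3 \<or> (\<forall>m. \<not> int p dvd m \<longrightarrow> m \<in> uminus -` W p) \<and> d p \<le> 1 - 1 / (3 * real p)
      \<or> uminus -` W p = UNIV" if "p \<noteq> 2"
    using defect[OF p that] by auto
qed (use nonneg le_one in auto)

text \<open>Without the multiples of \<open>p ^ k\<close> each set is periodic, and the Chinese
  remainder theorem gives the product. Restoring these multiples changes the proportion by at most
  the sum of \<open>1 / p ^ k\<close>, uniformly in \<open>N\<close>; so \<open>k\<close> is fixed
  first and then \<open>N\<close> tends to infinity.\<close>

lemma finite_inter_density:
  assumes P: "finite P" "\<And>p. p \<in> P \<Longrightarrow> prime p"
  shows "has_pos_density (\<Inter>p\<in>P. W p) (\<Prod>p\<in>P. d p)"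
proof -
  define A where "A k p = W p - {m. int (p ^ k) dvd m}" for k p
  define a where "a k p = real (card (A k p \<inter> {0..<int (p ^ (k + 3))})) / real p ^ (k + 3)" for k p
  define S where "S = (\<Inter>p\<in>P. W p)"
  define f where "f T N = real (card (T \<inter> {1..int N})) / real N" for T :: "int set" and N :: nat
  have A_dens: "f (\<Inter>p\<in>P. A k p) \<longlonglongrightarrow> (\<Prod>p\<in>P. a k p)" for k
  proof -
    have "coprime (p ^ (k + 3)) (q ^ (k + 3))" if "p \<in> P" "q \<in> P" "p \<noteq> q" for p q
      using that P(2) by (simp add: primes_coprime)
    then have *: "mod_periodic (\<Prod>p\<in>P. p ^ (k + 3)) (\<Inter>p\<in>P. A k p)"
      "card ((\<Inter>p\<in>P. A k p) \<inter> {0..<int (\<Prod>p\<in>P. p ^ (k + 3))})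
        = (\<Prod>p\<in>P. card (A k p \<inter> {0..<int (p ^ (k + 3))}))"
      using mod_periodic_INT[OF P(1), of "\<lambda>p. p ^ (k + 3)" "A k"] P(2) periodic
      by (simp_all add: A_def prime_gt_0_nat)
    have "has_pos_density (\<Inter>p\<in>P. A k p) (\<Prod>p\<in>P. a k p)"
      using mod_periodic_density[OF _ *(1)] P(2) unfolding *(2)
      by (simp add: a_def prod_dividef prime_gt_0_nat prod_pos)
    then show ?thesis unfolding has_pos_density_def f_def .
  qed
  have close: "f (\<Inter>p\<in>P. A k p) N \<le> f S N" "f S N \<le> f (\<Inter>p\<in>P. A k p) N + (\<Sum>p\<in>P. 1 / real p ^ k)"
    if "N > 0" for N k
  proof -
    have "card ((\<Inter>p\<in>P. A k p) \<inter> {1..int N}) \<le> card (S \<inter> {1..int N})"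
      by (intro card_mono) (auto simp: S_def A_def)
    then show "f (\<Inter>p\<in>P. A k p) N \<le> f S N" by (simp add: f_def divide_right_mono)
    have "S \<inter> {1..int N} \<subseteq> ((\<Inter>p\<in>P. A k p) \<inter> {1..int N})
        \<union> (\<Union>p\<in>P. {m. int (p ^ k) dvd m} \<inter> {1..int N})"
      by (auto simp: S_def A_def)
    then have "card (S \<inter> {1..int N}) \<le> card (((\<Inter>p\<in>P. A k p) \<inter> {1..int N})
        \<union> (\<Union>p\<in>P. {m. int (p ^ k) dvd m} \<inter> {1..int N}))"
      by (intro card_mono) (use P in auto)
    also have "\<dots> \<le> card ((\<Inter>p\<in>P. A k p) \<inter> {1..int N})
        + card (\<Union>p\<in>P. {m. int (p ^ k) dvd m} \<inter> {1..int N})"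
      by (rule card_Un_le)
    also have "\<dots> \<le> card ((\<Inter>p\<in>P. A k p) \<inter> {1..int N})
        + (\<Sum>p\<in>P. card ({m. int (p ^ k) dvd m} \<inter> {1..int N}))"
      using P by (intro add_left_mono card_UN_le)
    finally have "real (card (S \<inter> {1..int N})) \<le> card ((\<Inter>p\<in>P. A k p) \<inter> {1..int N})
        + (\<Sum>p\<in>P. real (card ({m. int (p ^ k) dvd m} \<inter> {1..int N})))"
      by (simp flip: of_nat_sum of_nat_add)
    also have "(\<Sum>p\<in>P. real (card ({m. int (p ^ k) dvd m} \<inter> {1..int N}))) \<le> (\<Sum>p\<in>P. real N / real p ^ k)"
    proof (rule sum_mono)
      fix p assume "p \<in> P"
      then show "real (card ({m. int (p ^ k) dvd m} \<inter> {1..int N})) \<le> real N / real p ^ k"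
        using card_multiples_le[of "p ^ k" N] P(2) by (simp add: prime_gt_0_nat)
    qed
    finally have "f S N \<le> (card ((\<Inter>p\<in>P. A k p) \<inter> {1..int N}) + (\<Sum>p\<in>P. real N / real p ^ k)) / N"
      by (simp add: f_def divide_right_mono)
    also have "\<dots> = f (\<Inter>p\<in>P. A k p) N + (\<Sum>p\<in>P. 1 / real p ^ k)"
      using that by (simp add: f_def add_divide_distrib sum_divide_distrib)
    finally show "f S N \<le> f (\<Inter>p\<in>P. A k p) N + (\<Sum>p\<in>P. 1 / real p ^ k)" .
  qed
  have pk: "(\<lambda>k. 1 / real p ^ k) \<longlonglongrightarrow> 0" if "p \<in> P" for p
  proof -
    have "1 < real p" using that P(2) prime_gt_1_nat by simp
    then show ?thesis
      using LIMSEQ_realpow_zero[of "1 / real p"] by (simp add: power_divide)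
  qed
  have "(\<lambda>k. a k p) \<longlonglongrightarrow> d p" if "p \<in> P" for p
  proof -
    have "(\<lambda>k. a k p - d p) \<longlonglongrightarrow> 0"
      by (rule Lim_null_comparison[OF _ pk[OF that]])
         (use approx P(2) that in \<open>auto simp: a_def A_def\<close>)
    then show ?thesis by (simp add: LIM_zero_iff)
  qed
  then have lim_a: "(\<lambda>k. \<Prod>p\<in>P. a k p) \<longlonglongrightarrow> (\<Prod>p\<in>P. d p)" by (rule tendsto_prod)
  have "(\<lambda>k. \<Sum>p\<in>P. 1 / real p ^ k) \<longlonglongrightarrow> (\<Sum>p\<in>P. 0)" using pk by (intro tendsto_sum)
  then have lim_s: "(\<lambda>k. \<Sum>p\<in>P. 1 / real p ^ k) \<longlonglongrightarrow> 0" by simp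
  have "f S \<longlonglongrightarrow> (\<Prod>p\<in>P. d p)"
  proof (rule LIMSEQ_I)
    fix \<epsilon> :: real assume "\<epsilon> > 0"
    then have e: "\<epsilon> / 3 > 0" by simp
    have "\<forall>\<^sub>F k in sequentially. dist (\<Prod>p\<in>P. a k p) (\<Prod>p\<in>P. d p) < \<epsilon> / 3
        \<and> dist (\<Sum>p\<in>P. 1 / real p ^ k) 0 < \<epsilon> / 3"
      by (intro eventually_conj tendstoD[OF lim_a e] tendstoD[OF lim_s e])
    then obtain k where k: "dist (\<Prod>p\<in>P. a k p) (\<Prod>p\<in>P. d p) < \<epsilon> / 3"
        "dist (\<Sum>p\<in>P. 1 / real p ^ k) 0 < \<epsilon> / 3"
      by (auto simp: eventually_sequentially)
    have "\<forall>\<^sub>F N in sequentially. dist (f (\<Inter>p\<in>P. A k p) N) (\<Prod>p\<in>P. a k p) < \<epsilon> / 3 \<and> 0 < N"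
      by (intro eventually_conj tendstoD[OF A_dens e] eventually_gt_at_top)
    then have "\<forall>\<^sub>F N in sequentially. norm (f S N - (\<Prod>p\<in>P. d p)) < \<epsilon>"
    proof eventually_elim
      case (elim N)
      then have "N > 0" and "\<bar>f (\<Inter>p\<in>P. A k p) N - (\<Prod>p\<in>P. a k p)\<bar> < \<epsilon> / 3" by (auto simp: dist_real_def)
      then show ?case using close[of N k] k unfolding dist_real_def real_norm_def by linarith
    qed
    then show "\<exists>N0. \<forall>N\<ge>N0. norm (f S N - (\<Prod>p\<in>P. d p)) < \<epsilon>"
      by (simp add: eventually_sequentially)
  qed
  then show ?thesis unfolding has_pos_density_def f_def S_def .
qed

text \<open>The weight bounds the proportion of integers missed by \<open>W p\<close> in every
  initial segment, while \<open>1 - d p\<close> is at least a third of it. The value 0 at 2 and off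
  the primes permits sums over all natural numbers; the prime 2 will be among the finitely many
  primes treated exactly.\<close>

definition weight :: "nat \<Rightarrow> real" where
  "weight p = (if prime p \<and> p \<noteq> 2 then
     SOME w. 0 \<le> w \<and> d p \<le> 1 - w / 3 \<and> (\<forall>N. real (card ({1..int N} - W p)) \<le> w * N) else 0)"

text \<open>The three cases of \<open>defect\<close> give the witnesses 1 (trivial count),
  \<open>1 / p\<close> (only multiples of \<open>p\<close> can be missed) and 0.\<close>

lemma defect_count:
  assumes p: "prime p" "p \<noteq> 2"
  shows "\<exists>w. 0 \<le> w \<and> d p \<le> 1 - w / 3 \<and> (\<forall>N. real (card ({1..int N} - W p)) \<le> w * N)"
proof -
  consider "d p \<le> 2 / 3" | "\<forall>m. \<not> int p dvd m \<longrightarrow> m \<in> W p" "d p \<le> 1 - 1 / (3 * real p)" | "W p = UNIV"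
    using defect[OF p] by blast
  then show ?thesis
  proof cases
    case 1
    have "card ({1..int N} - W p) \<le> N" for N
      using card_mono[of "{1..int N}" "{1..int N} - W p"] by simp
    then show ?thesis using 1 by (intro exI[of _ 1]) simp
  next
    case 2
    have "real (card ({1..int N} - W p)) \<le> 1 / real p * N" for N
    proof -
      have "{1..int N} - W p \<subseteq> {m. int p dvd m} \<inter> {1..int N}" using 2 by auto
      then have "card ({1..int N} - W p) \<le> card ({m. int p dvd m} \<inter> {1..int N})"
        by (intro card_mono) auto
      then show ?thesis using card_multiples_le[of p N] p by (simp add: prime_gt_0_nat)
    qed
    then show ?thesis using 2 by (intro exI[of _ "1 / real p"]) (simp add: mult.commute)
  next
    case 3
    then show ?thesis using le_one[OF p(1)] by (intro exI[of _ 0]) simp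
  qed
qed

lemma weight:
  "0 \<le> weight p"
  "prime p \<Longrightarrow> p \<noteq> 2 \<Longrightarrow> d p \<le> 1 - weight p / 3"
  "prime p \<Longrightarrow> p \<noteq> 2 \<Longrightarrow> real (card ({1..int N} - W p)) \<le> weight p * N"
proof -
  have *: "0 \<le> weight p \<and> d p \<le> 1 - weight p / 3 \<and> (\<forall>N. real (card ({1..int N} - W p)) \<le> weight p * N)"
    if "prime p" "p \<noteq> 2"
    using someI_ex[OF defect_count[OF that]] that by (simp add: weight_def)
  show "0 \<le> weight p" using * by (cases "prime p \<and> p \<noteq> 2") (auto simp: weight_def)
  show "prime p \<Longrightarrow> p \<noteq> 2 \<Longrightarrow> d p \<le> 1 - weight p / 3"
    and "prime p \<Longrightarrow> p \<noteq> 2 \<Longrightarrow> real (card ({1..int N} - W p)) \<le> weight p * N"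
    using * by auto
qed

text \<open>Each factor is bounded through \<open>1 - t \<le> exp (- t)\<close>, which turns the
  product into a sum of weights.\<close>

lemma prod_le_exp_weight:
  "(\<Prod>p | prime p \<and> p \<le> N. d p) \<le> exp (- (\<Sum>p\<le>N. weight p) / 3)"
proof -
  have "(\<Prod>p | prime p \<and> p \<le> N. d p) \<le> (\<Prod>p | prime p \<and> p \<le> N. exp (- weight p / 3))"
  proof (rule prod_mono)
    fix p assume "p \<in> {p. prime p \<and> p \<le> N}"
    then have p: "prime p" by simp
    have "d p \<le> 1 - weight p / 3"
      using p weight(2) le_one by (cases "p = 2") (auto simp: weight_def)
    also have "\<dots> \<le> exp (- weight p / 3)" using exp_ge_add_one_self[of "- weight p / 3"] by simp
    finally show "0 \<le> d p \<and> d p \<le> exp (- weight p / 3)" using nonneg[OF p] by simp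
  qed
  also have "\<dots> = exp (\<Sum>p | prime p \<and> p \<le> N. - weight p / 3)" by (simp add: exp_sum)
  also have "(\<Sum>p | prime p \<and> p \<le> N. - weight p / 3) = (\<Sum>p\<le>N. - weight p / 3)"
    by (rule sum.mono_neutral_left) (auto simp: weight_def)
  also have "\<dots> = - (\<Sum>p\<le>N. weight p) / 3" by (simp add: sum_negf sum_divide_distrib)
  finally show ?thesis .
qed

text \<open>Taking logarithms in \<open>prod_le_exp_weight\<close> bounds all partial sums of the
  weights by \<open>- 3 * ln \<delta>\<close>.\<close>

lemma summable_weight:
  assumes "\<delta> > 0" "\<And>N. \<delta> \<le> (\<Prod>p | prime p \<and> p \<le> N. d p)"
  shows "summable weight"
proof (rule summableI_nonneg_bounded)
  fix N
  have "\<delta> \<le> exp (- (\<Sum>p\<le>N. weight p) / 3)" using assms(2) prod_le_exp_weight order_trans by blast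
  then have "ln \<delta> \<le> - (\<Sum>p\<le>N. weight p) / 3" using assms(1) by (metis exp_gt_zero ln_exp ln_le_cancel_iff)
  moreover have "(\<Sum>p<N. weight p) \<le> (\<Sum>p\<le>N. weight p)"
    by (intro sum_mono2) (auto simp: weight)
  ultimately show "(\<Sum>p<N. weight p) \<le> - 3 * ln \<delta>" by simp
qed (rule weight)

text \<open>The partial products decrease to a limit \<open>\<delta>\<close>. Each finite
  intersection contains the full one, which gives the upper bound; the lower bound comes from the
  tail of the weights and is invoked only if \<open>\<delta> > 0\<close>.\<close>

theorem density_product:
  "\<exists>\<delta>. (\<lambda>N. \<Prod>p | prime p \<and> p \<le> N. d p) \<longlonglongrightarrow> \<delta> \<and>
    has_pos_density {m. \<forall>p. prime p \<longrightarrow> m \<in> W p} \<delta>"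
proof -
  define D where "D N = (\<Prod>p | prime p \<and> p \<le> N. d p)" for N
  define S where "S = {m. \<forall>p. prime p \<longrightarrow> m \<in> W p}"
  define T where "T N = (\<Inter>p\<in>{p. prime p \<and> p \<le> N}. W p)" for N
  define f where "f T N = real (card (T \<inter> {1..int N})) / real N" for T :: "int set" and N :: nat
  have D0: "0 \<le> D N" for N unfolding D_def by (intro prod_nonneg) (use nonneg in auto)
  have "decseq D"
  proof (rule decseq_SucI)
    fix N
    have "{p. prime p \<and> p \<le> Suc N} = (if prime (Suc N) then insert (Suc N) {p. prime p \<and> p \<le> N}
        else {p. prime p \<and> p \<le> N})"
      by (auto simp: le_Suc_eq)
    then have "D (Suc N) = (if prime (Suc N) then d (Suc N) * D N else D N)"
      by (simp add: D_def)
    then show "D (Suc N) \<le> D N" using D0[of N] le_one[of "Suc N"] by (simp add: mult_left_le_one_le nonneg)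
  qed
  then obtain \<delta> where \<delta>: "D \<longlonglongrightarrow> \<delta>" "\<And>N. \<delta> \<le> D N"
    using decseq_convergent[of D 0] D0 by blast
  have \<delta>0: "0 \<le> \<delta>" using D0 by (intro LIMSEQ_le_const[OF \<delta>(1)]) auto
  have T_dens: "f (T N) \<longlonglongrightarrow> D N" for N
  proof -
    have "has_pos_density (T N) (D N)" unfolding T_def D_def by (rule finite_inter_density) auto
    then show ?thesis unfolding has_pos_density_def f_def .
  qed
  have upper: "f S K \<le> f (T N) K" for N K
    unfolding f_def by (intro divide_right_mono of_nat_mono card_mono) (auto simp: S_def T_def)
  \<comment> \<open>An element of \<open>T N\<close> outside \<open>S\<close> is missed by
    \<open>W p\<close> for some prime \<open>p > N\<close>; the union bound over such primes costs
    at most the tail of the weights.\<close>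
  have lower: "f (T N) K \<le> f S K + (\<Sum>p. weight (p + Suc N))"
    if N: "N \<ge> 2" and K: "K > 0" and sm: "summable weight" for N K
  proof -
    define E where "E = (T N - S) \<inter> {1..int K}"
    have "\<forall>m\<in>E. \<exists>p. prime p \<and> p > N \<and> m \<notin> W p"
    proof
      fix m assume m: "m \<in> E"
      then obtain p where "prime p" "m \<notin> W p" by (auto simp: E_def S_def)
      moreover from this have "\<not> p \<le> N" using m by (auto simp: E_def T_def)
      ultimately show "\<exists>p. prime p \<and> p > N \<and> m \<notin> W p" by auto
    qed
    \<comment> \<open>Choosing one prime per element keeps the union finite.\<close>
    then obtain g where g: "\<And>m. m \<in> E \<Longrightarrow> prime (g m) \<and> g m > N \<and> m \<notin> W (g m)" by metis
    have finE: "finite E" by (simp add: E_def)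
    have "card E \<le> card (\<Union>p\<in>g ` E. {1..int K} - W p)"
      by (intro card_mono) (use g in \<open>auto simp: finE E_def\<close>)
    also have "\<dots> \<le> (\<Sum>p\<in>g ` E. card ({1..int K} - W p))" by (intro card_UN_le) (simp add: finE)
    finally have "real (card E) \<le> (\<Sum>p\<in>g ` E. real (card ({1..int K} - W p)))"
      by (simp flip: of_nat_sum)
    also have "\<dots> \<le> (\<Sum>p\<in>g ` E. weight p * K)"
      by (intro sum_mono weight(3)) (use g N in fastforce)+
    also have "\<dots> = (\<Sum>p\<in>g ` E. weight p) * K" by (simp add: sum_distrib_right)
    \<comment> \<open>Subtracting \<open>Suc N\<close> turns primes above \<open>N\<close> into
      indices of the shifted series; truncated subtraction is injective on them.\<close>
    also have "(\<Sum>p\<in>g ` E. weight p) = (\<Sum>q\<in>(\<lambda>p. p - Suc N) ` g ` E. weight (q + Suc N))"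
    proof (subst sum.reindex[of "\<lambda>p. p - Suc N" "g ` E"])
      show "inj_on (\<lambda>p. p - Suc N) (g ` E)"
        using g by (intro inj_onI) (metis Suc_leI diff_Suc_eq_diff_pred eq_diff_iff imageE)
      show "sum weight (g ` E) = sum ((\<lambda>q. weight (q + Suc N)) \<circ> (\<lambda>p. p - Suc N)) (g ` E)"
      proof (rule sum.cong)
        fix p assume "p \<in> g ` E"
        then have "p - Suc N + Suc N = p" using g by fastforce
        then show "weight p = ((\<lambda>q. weight (q + Suc N)) \<circ> (\<lambda>p. p - Suc N)) p" by (simp only: o_apply)
      qed simp
    qed
    also have "\<dots> \<le> (\<Sum>p. weight (p + Suc N))"
      by (intro sum_le_suminf summable_ignore_initial_segment sm) (auto simp: finE weight)
    finally have E: "real (card E) \<le> (\<Sum>p. weight (p + Suc N)) * K" by (simp add: mult_right_mono)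
    have "T N \<inter> {1..int K} \<subseteq> S \<inter> {1..int K} \<union> E" by (auto simp: E_def)
    then have "card (T N \<inter> {1..int K}) \<le> card (S \<inter> {1..int K} \<union> E)"
      by (intro card_mono) (auto simp: finE)
    also have "\<dots> \<le> card (S \<inter> {1..int K}) + card E" by (rule card_Un_le)
    finally have "real (card (T N \<inter> {1..int K})) \<le> card (S \<inter> {1..int K}) + real (card E)" by linarith
    also note E
    finally have "f (T N) K \<le> (card (S \<inter> {1..int K}) + (\<Sum>p. weight (p + Suc N)) * K) / K"
      by (simp add: f_def divide_right_mono)
    also have "\<dots> = f S K + (\<Sum>p. weight (p + Suc N))"
      using K by (simp add: f_def add_divide_distrib)
    finally show ?thesis .
  qed
  have "f S \<longlonglongrightarrow> \<delta>"
  proof (rule LIMSEQ_I)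
    fix \<epsilon> :: real assume "\<epsilon> > 0"
    then have e: "\<epsilon> / 3 > 0" by simp
    have "\<exists>N. D N < \<delta> + \<epsilon> / 3 \<and> (\<delta> > 0 \<longrightarrow> (\<forall>K>0. f (T N) K - \<epsilon> / 3 \<le> f S K))"
    proof (cases "\<delta> > 0")
      case True
      then have sm: "summable weight" using summable_weight[of \<delta>] \<delta>(2) by (simp add: D_def)
      have "(\<lambda>N. \<Sum>p. weight (p + N)) \<longlonglongrightarrow> 0" by (rule suminf_exist_split2[OF sm])
      then have tail: "(\<lambda>N. \<Sum>p. weight (p + Suc N)) \<longlonglongrightarrow> 0" by (rule LIMSEQ_Suc)
      have "\<forall>\<^sub>F N in sequentially. dist (D N) \<delta> < \<epsilon> / 3
          \<and> dist (\<Sum>p. weight (p + Suc N)) 0 < \<epsilon> / 3 \<and> N \<ge> 2"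
        by (intro eventually_conj tendstoD[OF \<delta>(1) e] tendstoD[OF tail e] eventually_ge_at_top)
      then obtain N where N: "dist (D N) \<delta> < \<epsilon> / 3" "dist (\<Sum>p. weight (p + Suc N)) 0 < \<epsilon> / 3" "N \<ge> 2"
        by (auto simp: eventually_sequentially)
      have "f (T N) K - \<epsilon> / 3 \<le> f S K" if "K > 0" for K
        using lower[OF N(3) that sm] N(2) by (simp add: dist_real_def)
      moreover have "D N < \<delta> + \<epsilon> / 3" using N(1) unfolding dist_real_def by linarith
      ultimately show ?thesis by blast
    next
      case False
      obtain N where "dist (D N) \<delta> < \<epsilon> / 3"
        using tendstoD[OF \<delta>(1) e] by (auto simp: eventually_sequentially)
      then have "D N < \<delta> + \<epsilon> / 3" unfolding dist_real_def by linarith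
      then show ?thesis using False by blast
    qed
    then obtain N where N: "D N < \<delta> + \<epsilon> / 3"
        "\<And>K. K > 0 \<Longrightarrow> \<delta> > 0 \<Longrightarrow> f (T N) K - \<epsilon> / 3 \<le> f S K"
      by blast
    have "\<forall>\<^sub>F K in sequentially. dist (f (T N) K) (D N) < \<epsilon> / 3 \<and> 0 < K"
      by (intro eventually_conj tendstoD[OF T_dens e] eventually_gt_at_top)
    then have "\<forall>\<^sub>F K in sequentially. norm (f S K - \<delta>) < \<epsilon>"
    proof eventually_elim
      case (elim K)
      then have "\<bar>f (T N) K - D N\<bar> < \<epsilon> / 3" by (simp add: dist_real_def)
      moreover have "0 \<le> f S K" by (simp add: f_def)
      \<comment> \<open>For \<open>\<delta> = 0\<close> the bound \<open>0 \<le> f S K\<close> takes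
        the place of the lower estimate.\<close>
      moreover have "\<delta> = 0 \<or> f (T N) K - \<epsilon> / 3 \<le> f S K" using N(2)[of K] elim \<delta>0 by force
      ultimately show ?case
        using upper[of K N] N(1) \<delta>(2)[of N] \<open>\<epsilon> > 0\<close> unfolding real_norm_def by linarith
    qed
    then show "\<exists>N0. \<forall>N\<ge>N0. norm (f S N - \<delta>) < \<epsilon>" by (simp add: eventually_sequentially)
  qed
  then show ?thesis using \<delta>(1) unfolding has_pos_density_def f_def S_def D_def by blast
qed

end


section \<open>Subsets of the p-adic integers stable under squares\<close>

definition padic_of_int :: "nat \<Rightarrow> int \<Rightarrow> nat \<Rightarrow> int" where
  "padic_of_int p m = (\<lambda>k. m mod int p ^ k)"

lemma padic_of_int_carrier: "p > 0 \<Longrightarrow> padic_of_int p m \<in> carrier (padic_int p)"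
  unfolding padic_of_int_def by (rule padic_int_closed) auto

lemma padic_of_int_mult:
  "padic_of_int p a \<otimes>\<^bsub>padic_int p\<^esub> padic_of_int p b = padic_of_int p (a * b)"
  by (simp add: padic_of_int_def padic_int_simps mod_simps)

text \<open>
  Newton approximation for the equation \<open>x u\<^sup>2 = y\<close>, carried out on \<open>x\<close> itself so that no division by
  \<open>p ^ j\<close> is needed. The exponent 3 for \<open>p = 2\<close> accounts for the factor 2 in the derivative.
\<close>

lemma padic_square_class:
  assumes p: "prime p" and x: "x \<in> carrier (padic_int p)" and y: "y \<in> carrier (padic_int p)"
    and xj: "x j = 0" "x (Suc j) \<noteq> 0"
    and xy: "y (j + (if p = 2 then 3 else 1)) = x (j + (if p = 2 then 3 else 1))"
  shows "\<exists>u\<in>carrier (padic_int p). y = u \<otimes>\<^bsub>padic_int p\<^esub> u \<otimes>\<^bsub>padic_int p\<^esub> x"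
proof -
  \<comment> \<open>\<open>h\<close> is the p-adic valuation of 2 and \<open>c\<close> its unit
    part, so \<open>2 = c * P ^ h\<close> treats even and odd \<open>p\<close> at once.\<close>
  define h :: nat where "h = (if p = 2 then 1 else 0)"
  define c :: int where "c = (if p = 2 then 1 else 2)"
  \<comment> \<open>Precision at step \<open>i\<close>: \<open>j\<close> from the valuation of
    \<open>x\<close>, \<open>h\<close> from the factor 2 in the derivative, and
    \<open>i + 1 + h\<close> from the size of the next correction.\<close>
  define M where "M i = i + j + 1 + h + h" for i
  define P where "P = int p"
  have pP: "prime P" using p by (simp add: P_def)
  have P0: "P > 0" using pP by (simp add: prime_gt_0_int)
  have two: "2 = c * P ^ h" by (simp add: c_def h_def P_def)
  have c: "\<not> P dvd c"
  proof (cases "p = 2")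
    case True
    then show ?thesis by (simp add: c_def P_def)
  next
    case False
    then have "\<not> p dvd 2" using p primes_dvd_imp_eq[of p 2] two_is_prime_nat by blast
    then show ?thesis using False by (simp add: c_def P_def int_dvd_int_iff[of p 2, simplified])
  qed
  have xM: "\<exists>z. x i = P ^ j * z \<and> \<not> P dvd z" if "Suc j \<le> i" for i
  proof -
    have "x i mod P ^ j = 0" using padic_int_mod[OF x, of j i] that xj by (simp add: P_def)
    then obtain z where z: "x i = P ^ j * z" by (metis dvd_def mod_eq_0_iff_dvd)
    have "\<not> P dvd z"
    proof
      assume "P dvd z"
      then have "P ^ Suc j dvd x i" using z by (auto elim!: dvdE)
      then show False using padic_int_mod[OF x that] xj by (simp add: P_def)
    qed
    then show ?thesis using z by blast
  qed
  define Q where "Q i v \<longleftrightarrow> P ^ M i dvd x (M i) * v\<^sup>2 - y (M i) \<and> \<not> P dvd v" for i v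
  have "\<exists>v. \<forall>i. Q i (v i) \<and> P ^ (i + 1 + h) dvd v (Suc i) - v i"
  proof (rule dependent_nat_choice)
    \<comment> \<open>\<open>M 0\<close> is exactly the level at which \<open>x\<close> and
      \<open>y\<close> are assumed to agree, so 1 is a starting approximation.\<close>
    have "x (M 0) = y (M 0)" using xy by (cases "p = 2") (simp_all add: M_def h_def numeral_3_eq_3)
    moreover have "\<not> P dvd 1" using pP by (simp add: prime_int_iff)
    ultimately show "\<exists>v. Q 0 v" unfolding Q_def by (intro exI[of _ 1]) auto
  next
    fix v i assume Q: "Q i v"
    define x' where "x' = x (M (Suc i))"
    define y' where "y' = y (M (Suc i))"
    obtain z where z: "x' = P ^ j * z" "\<not> P dvd z"
      using xM[of "M (Suc i)"] by (auto simp: x'_def M_def)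
    have "x' mod P ^ M i = x (M i)" "y' mod P ^ M i = y (M i)"
      using padic_int_mod[OF x, of "M i" "M (Suc i)"] padic_int_mod[OF y, of "M i" "M (Suc i)"]
      by (simp_all add: x'_def y'_def M_def P_def)
    moreover have "(x (M i) * v\<^sup>2 - y (M i)) mod P ^ M i = 0" using Q by (simp add: Q_def)
    ultimately have "(x' * v\<^sup>2 - y') mod P ^ M i = 0" by (metis mod_diff_eq mod_mult_left_eq mod_mod_trivial)
    then obtain s where s: "x' * v\<^sup>2 - y' = P ^ M i * s" by (metis dvd_def mod_eq_0_iff_dvd)
    have "\<not> P dvd c * z * v" using c z Q pP by (simp add: Q_def prime_dvd_mult_iff)
    then have "coprime (c * z * v) P" using pP by (metis prime_imp_coprime coprime_commute)
    then obtain b where b: "[c * z * v * b = 1] (mod P)" using cong_solve_coprime_int by blast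
    \<comment> \<open>Newton step: \<open>t\<close> solves the linearised congruence, cancelling the
      error coefficient \<open>s\<close> modulo \<open>P\<close>.\<close>
    define t where "t = - s * b"
    have t: "P dvd s + c * z * v * t"
    proof -
      have "P dvd c * z * v * b - 1" using b by (simp add: cong_iff_dvd_diff)
      then have "P dvd - s * (c * z * v * b - 1)" by (rule dvd_mult)
      then show ?thesis by (simp add: t_def algebra_simps)
    qed
    define v' where "v' = v + t * P ^ (i + 1 + h)"
    have "x' * v'\<^sup>2 - y' = (x' * v\<^sup>2 - y') + 2 * x' * v * t * P ^ (i + 1 + h) + x' * t\<^sup>2 * (P ^ (i + 1 + h))\<^sup>2"
      by (simp add: v'_def power2_eq_square algebra_simps)
    \<comment> \<open>Once \<open>P ^ M i\<close> is factored out, the linear term has the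
      coefficient \<open>c * z * v\<close>, invertible modulo \<open>P\<close>, while the quadratic
      term keeps a further factor \<open>P\<close>.\<close>
    also have "2 * x' * v * t * P ^ (i + 1 + h) = P ^ M i * (c * z * v * t)"
      unfolding two z M_def by (simp add: power_add mult_2 algebra_simps)
    also have "x' * t\<^sup>2 * (P ^ (i + 1 + h))\<^sup>2 = P ^ M i * (P * (z * t\<^sup>2 * P ^ i))"
      unfolding z M_def by (simp add: power_add mult_2 power2_eq_square algebra_simps)
    finally have "x' * v'\<^sup>2 - y' = P ^ M i * (s + c * z * v * t + P * (z * t\<^sup>2 * P ^ i))"
      using s by (simp add: algebra_simps)
    moreover have "P dvd s + c * z * v * t + P * (z * t\<^sup>2 * P ^ i)" by (rule dvd_add[OF t]) simp
    moreover have "P ^ M (Suc i) = P ^ M i * P" by (simp add: M_def)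
    ultimately have "P ^ M (Suc i) dvd x' * v'\<^sup>2 - y'" by (simp add: mult_dvd_mono)
    moreover have "\<not> P dvd v'"
      using Q by (simp add: v'_def Q_def dvd_add_left_iff)
    ultimately have "Q (Suc i) v'" by (simp add: Q_def x'_def y'_def)
    then show "\<exists>v'. Q (Suc i) v' \<and> P ^ (i + 1 + h) dvd v' - v"
      by (intro exI[of _ v']) (simp add: v'_def)
  qed
  then obtain v where v: "\<And>i. Q i (v i)" "\<And>i. P ^ (i + 1 + h) dvd v (Suc i) - v i" by blast
  define u where "u = (\<lambda>k. v k mod int p ^ k)"
  have "u \<in> carrier (padic_int p)"
    unfolding u_def
  proof (rule padic_int_closed)
    show "p > 0" using p by (simp add: prime_gt_0_nat)
    fix k
    have "P ^ k dvd v (Suc k) - v k"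
      using v(2)[of k] by (rule dvd_trans[rotated]) (simp add: le_imp_power_dvd)
    then show "v (Suc k) mod int p ^ k = v k mod int p ^ k" by (simp add: P_def mod_eq_dvd_iff)
  qed
  moreover have "y = u \<otimes>\<^bsub>padic_int p\<^esub> u \<otimes>\<^bsub>padic_int p\<^esub> x"
  proof
    fix k
    have le: "k \<le> M k" by (simp add: M_def)
    have "P ^ k dvd x (M k) * (v k)\<^sup>2 - y (M k)"
      using v(1)[of k] unfolding Q_def by (meson dvd_trans le le_imp_power_dvd)
    then have "(x (M k) * (v k)\<^sup>2) mod P ^ k = y (M k) mod P ^ k" by (simp add: mod_eq_dvd_iff)
    then have "(x k * (v k)\<^sup>2) mod P ^ k = y k"
      using padic_int_mod[OF x le] padic_int_mod[OF y le] by (metis P_def mod_mult_left_eq)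
    then show "y k = (u \<otimes>\<^bsub>padic_int p\<^esub> u \<otimes>\<^bsub>padic_int p\<^esub> x) k"
      by (simp add: u_def padic_int_simps P_def mod_simps power2_eq_square mult.commute)
  qed
  ultimately show ?thesis by blast
qed

text \<open>\<open>j\<close> is the p-adic valuation of \<open>x\<close>, found as the last zero
  level before the first nonzero one; level 0 is always zero.\<close>

lemma padic_valuation:
  assumes "x \<in> carrier (padic_int p)" "x k \<noteq> 0"
  obtains j where "j < k" "x j = 0" "x (Suc j) \<noteq> 0"
proof -
  have "x 0 = 0" using padic_int_memD(1,2)[OF assms(1), of 0] by simp
  then have "\<exists>j<k. x j = 0 \<and> x (Suc j) \<noteq> 0"
    using assms(2) by (induction k) (auto simp: less_Suc_eq)
  then show thesis using that by blast
qed

text \<open>\<open>u\<close> ranges over all p-adic integers, not only units: \<open>u = 0\<close>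
  puts 0 into \<open>V\<close>, and \<open>u = p\<close> passes membership from \<open>m\<close> to
  \<open>p ^ 2 * m\<close>.\<close>

locale padic_square_closed =
  fixes p :: nat and V :: "(nat \<Rightarrow> int) set"
  assumes prime: "prime p" and subset: "V \<subseteq> carrier (padic_int p)" and nonempty: "V \<noteq> {}"
    and square_mult: "x \<in> V \<Longrightarrow> u \<in> carrier (padic_int p) \<Longrightarrow> u \<otimes>\<^bsub>padic_int p\<^esub> u \<otimes>\<^bsub>padic_int p\<^esub> x \<in> V"
begin

definition W :: "int set" where "W = {m. padic_of_int p m \<in> V}"

lemma p_pos: "p > 0" using prime by (simp add: prime_gt_0_nat)

lemma zero_mem: "(\<lambda>k. 0) \<in> V"
proof -
  obtain x where "x \<in> V" using nonempty by blast
  then have "padic_of_int p 0 \<otimes>\<^bsub>padic_int p\<^esub> padic_of_int p 0 \<otimes>\<^bsub>padic_int p\<^esub> x \<in> V"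
    using square_mult padic_of_int_carrier p_pos by blast
  then show ?thesis by (simp add: padic_of_int_def padic_int_simps)
qed

lemma mem_cong_imp:
  assumes "x \<in> V" "y \<in> carrier (padic_int p)" "x j = 0" "x (Suc j) \<noteq> 0"
    "y (j + (if p = 2 then 3 else 1)) = x (j + (if p = 2 then 3 else 1))"
  shows "y \<in> V"
  using padic_square_class[OF prime _ assms(2-5)] subset assms(1) square_mult by blast

text \<open>The valuation \<open>j\<close> of \<open>x\<close> is below \<open>k\<close>, so
  agreement at level \<open>k + 3\<close> is enough for \<open>padic_square_class\<close>, also when
  \<open>p = 2\<close>. As \<open>y\<close> has the same valuation, the argument runs in both
  directions.\<close>

lemma mem_cong:
  assumes x: "x \<in> carrier (padic_int p)" and y: "y \<in> carrier (padic_int p)"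
    and xk: "x k \<noteq> 0" and eq: "y (k + 3) = x (k + 3)"
  shows "y \<in> V \<longleftrightarrow> x \<in> V"
proof -
  have level: "y i = x i" if "i \<le> k + 3" for i
    using padic_int_mod[OF x that] padic_int_mod[OF y that] eq by simp
  obtain j where j: "j < k" "x j = 0" "x (Suc j) \<noteq> 0" using padic_valuation[OF x xk] .
  have "y (j + (if p = 2 then 3 else 1)) = x (j + (if p = 2 then 3 else 1))" "y j = x j" "y (Suc j) = x (Suc j)"
    using j by (intro level; simp)+
  then show ?thesis using mem_cong_imp[of x y j] mem_cong_imp[of y x j] x y j by auto
qed

lemma W_periodic: "mod_periodic (p ^ (k + 3)) (W - {m. int (p ^ k) dvd m})"
  unfolding mod_periodic_def
proof
  fix m
  define r where "r = m mod int (p ^ (k + 3))"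
  have dvd: "int (p ^ k) dvd r \<longleftrightarrow> int (p ^ k) dvd m"
    unfolding r_def by (rule dvd_mod_iff) (simp add: power_add)
  have "padic_of_int p r \<in> V \<longleftrightarrow> padic_of_int p m \<in> V" if "\<not> int (p ^ k) dvd m"
  proof (rule mem_cong)
    show "padic_of_int p m k \<noteq> 0" using that by (simp add: padic_of_int_def dvd_eq_mod_eq_0)
    show "padic_of_int p r (k + 3) = padic_of_int p m (k + 3)"
      by (simp add: r_def padic_of_int_def)
  qed (simp_all add: padic_of_int_carrier p_pos)
  then show "m mod int (p ^ (k + 3)) \<in> W - {m. int (p ^ k) dvd m} \<longleftrightarrow> m \<in> W - {m. int (p ^ k) dvd m}"
    using dvd unfolding r_def[symmetric] by (auto simp: W_def)
qed

text \<open>By \<open>mem_cong\<close>, the elements of \<open>V\<close> not divisible by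
  \<open>p ^ k\<close> fill whole balls of level \<open>k + 3\<close>, and each such ball contains
  an integer deciding its membership.\<close>

lemma restrict_eq_balls:
  "{x \<in> V. x k \<noteq> 0} =
    (\<Union>r\<in>(W - {m. int (p ^ k) dvd m}) \<inter> {0..<int (p ^ (k + 3))}. padic_ball p (k + 3) r)"
    (is "?L = (\<Union>r\<in>?R. _)")
proof
  show "?L \<subseteq> (\<Union>r\<in>?R. padic_ball p (k + 3) r)"
  proof
    fix x assume "x \<in> ?L"
    then have x: "x \<in> V" "x k \<noteq> 0" "x \<in> carrier (padic_int p)" using subset by auto
    define r where "r = x (k + 3)"
    have rk: "r mod int p ^ k = x k" unfolding r_def by (rule padic_int_mod) (use x in auto)
    have "padic_of_int p r \<in> V"
      using mem_cong[of x "padic_of_int p r" k] x padic_of_int_carrier[OF p_pos] padic_int_memD(4)[OF x(3), of "k + 3"]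
      by (simp add: r_def padic_of_int_def)
    moreover have "\<not> int (p ^ k) dvd r" using rk x by (auto simp: dvd_eq_mod_eq_0)
    moreover have "r \<in> {0..<int (p ^ (k + 3))}" using padic_int_memD(1,2)[OF x(3)] by (simp add: r_def)
    ultimately have "r \<in> ?R" by (simp add: W_def)
    then show "x \<in> (\<Union>r\<in>?R. padic_ball p (k + 3) r)" using x by (auto simp: padic_ball_def r_def)
  qed
  show "(\<Union>r\<in>?R. padic_ball p (k + 3) r) \<subseteq> ?L"
  proof
    fix x assume "x \<in> (\<Union>r\<in>?R. padic_ball p (k + 3) r)"
    then obtain r where r: "r \<in> ?R" and x: "x \<in> carrier (padic_int p)" "x (k + 3) = r"
      by (auto simp: padic_ball_def)
    have *: "padic_of_int p r k \<noteq> 0" using r by (simp add: padic_of_int_def dvd_eq_mod_eq_0)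
    have "padic_of_int p r (k + 3) = r" using r by (simp add: padic_of_int_def)
    then have "x \<in> V"
      using mem_cong[of "padic_of_int p r" x k] x r * padic_of_int_carrier[OF p_pos] by (simp add: W_def)
    moreover have "x k = padic_of_int p r k"
      using padic_int_mod[OF x(1), of k "k + 3"] x(2) by (simp add: padic_of_int_def)
    ultimately show "x \<in> ?L" using * by simp
  qed
qed

section \<open>Haar measure of a square-closed set\<close>

lemma sets_V: "V \<in> sets (padic_borel p)"
proof -
  \<comment> \<open>The balls around 0 intersect in the single point 0, which lies in
    \<open>V\<close>; the rest is a countable union of finite unions of balls.\<close>
  have eq: "V = (\<Inter>k. padic_ball p k 0) \<union> (\<Union>k. {x \<in> V. x k \<noteq> 0})"
  proof
    show "V \<subseteq> (\<Inter>k. padic_ball p k 0) \<union> (\<Union>k. {x \<in> V. x k \<noteq> 0})"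
      using subset by (auto simp: padic_ball_def)
    have "x = (\<lambda>k. 0)" if "x \<in> (\<Inter>k. padic_ball p k 0)" for x
      using that by (auto simp: padic_ball_def)
    then show "(\<Inter>k. padic_ball p k 0) \<union> (\<Union>k. {x \<in> V. x k \<noteq> 0}) \<subseteq> V"
      using zero_mem by auto
  qed
  have "{x \<in> V. x k \<noteq> 0} \<in> sets (padic_borel p)" for k
    unfolding restrict_eq_balls by (intro sets.finite_UN) auto
  then show ?thesis by (subst eq) (intro sets.Un sets.countable_INT sets.countable_UN; auto)
qed

lemma haar: "is_padic_haar p (padic_haar p)"
  by (rule is_padic_haar_padic_haar[OF p_pos])

lemma sets_haar: "sets (padic_haar p) = sets (padic_borel p)"
  using haar by (simp add: is_padic_haar_def)

lemma space_haar: "space (padic_haar p) = carrier (padic_int p)"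
  using sets_eq_imp_space_eq[OF sets_haar] by (simp add: space_padic_borel)

sublocale haar: prob_space "padic_haar p"
  by standard (use haar in \<open>simp add: is_padic_haar_def space_haar\<close>)

lemma measure_ball: "r \<in> {0..<int p ^ k} \<Longrightarrow> measure (padic_haar p) (padic_ball p k r) = 1 / real p ^ k"
  using padic_haar_ball[OF p_pos haar, of r k] p_pos
  by (simp add: measure_def ennreal_of_nat_eq_real_of_nat divide_ennreal flip: ennreal_1)

lemma measure_balls:
  assumes "R \<subseteq> {0..<int p ^ k}"
  shows "measure (padic_haar p) (\<Union>r\<in>R. padic_ball p k r) = card R / real p ^ k"
proof -
  have "finite R" using assms finite_subset by blast
  then have "measure (padic_haar p) (\<Union>r\<in>R. padic_ball p k r) = (\<Sum>r\<in>R. measure (padic_haar p) (padic_ball p k r))"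
    by (intro haar.finite_measure_finite_Union) (auto simp: sets_haar disjoint_family_on_def, auto simp: padic_ball_def)
  also have "\<dots> = (\<Sum>r\<in>R. 1 / real p ^ k)"
    using assms measure_ball by (intro sum.cong) auto
  finally show ?thesis by simp
qed

text \<open>The quotient is the measure of the part of \<open>V\<close> outside
  \<open>padic_ball p k 0\<close>, since that part is a disjoint union of balls indexed by the
  counted residues. The ball left out has measure \<open>1 / real p ^ k\<close>.\<close>

lemma measure_approx:
  "\<bar>card ((W - {m. int (p ^ k) dvd m}) \<inter> {0..<int (p ^ (k + 3))}) / real p ^ (k + 3)
    - measure (padic_haar p) V\<bar> \<le> 1 / real p ^ k"
proof -
  have meas: "{x \<in> V. x k \<noteq> 0} \<in> sets (padic_haar p)"
    unfolding restrict_eq_balls by (intro sets.finite_UN) (auto simp: sets_haar)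
  have eq: "card ((W - {m. int (p ^ k) dvd m}) \<inter> {0..<int (p ^ (k + 3))}) / real p ^ (k + 3)
      = measure (padic_haar p) {x \<in> V. x k \<noteq> 0}"
    unfolding restrict_eq_balls by (subst measure_balls) auto
  have "measure (padic_haar p) {x \<in> V. x k \<noteq> 0} \<le> measure (padic_haar p) V"
    by (intro haar.finite_measure_mono) (auto simp: sets_haar sets_V)
  moreover have "measure (padic_haar p) V \<le> measure (padic_haar p) ({x \<in> V. x k \<noteq> 0} \<union> padic_ball p k 0)"
    using subset by (intro haar.finite_measure_mono sets.Un meas) (simp_all add: sets_haar, auto simp: padic_ball_def)
  moreover have "\<dots> \<le> measure (padic_haar p) {x \<in> V. x k \<noteq> 0} + measure (padic_haar p) (padic_ball p k 0)"
    by (intro measure_Un_le meas) (simp add: sets_haar)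
  moreover have "measure (padic_haar p) (padic_ball p k 0) = 1 / real p ^ k"
    using p_pos by (intro measure_ball) simp
  ultimately show ?thesis unfolding eq by (simp add: abs_le_iff)
qed

text \<open>
  The complement of \<open>V\<close> is also stable under multiplication by unit squares, so it contains, along with
  \<open>x\<close>, the \<open>(p - 1) / 2\<close> balls around the elements \<open>x s\<^sup>2\<close>.
\<close>

lemma measure_le_of_missing:
  assumes odd: "p \<noteq> 2" and x: "x \<in> carrier (padic_int p)" "x \<notin> V" and xj: "x j = 0" "x (Suc j) \<noteq> 0"
  shows "measure (padic_haar p) V \<le> 1 - (real p - 1) / (2 * real p ^ Suc j)"
proof -
  \<comment> \<open>The number of nonzero squares modulo \<open>p\<close>; \<open>1, ..., h\<close>
    represent the nonzero residues up to sign.\<close>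
  define h where "h = (p - 1) div 2"
  have "odd p" using odd prime prime_odd_nat[of p] prime_ge_2_nat[of p] by force
  then have h: "p = 2 * h + 1" by (auto simp: h_def elim!: oddE)
  define P where "P = int p"
  have pP: "prime P" using prime by (simp add: P_def)
  have P0: "P > 0" using pP by (simp add: prime_gt_0_int)
  define x' where "x' = x (Suc j)"
  have "x' mod P ^ j = 0" using padic_int_memD(3)[OF x(1), of j] xj by (simp add: x'_def P_def)
  then obtain z where z: "x' = P ^ j * z" by (metis dvd_def mod_eq_0_iff_dvd)
  have zP: "\<not> P dvd z"
  proof
    assume "P dvd z"
    then have "P ^ Suc j dvd x'" using z by (auto elim!: dvdE)
    then show False using padic_int_memD(4)[OF x(1), of "Suc j"] xj by (simp add: x'_def P_def)
  qed
  \<comment> \<open>Level \<open>Suc j\<close> is the first at which \<open>x\<close> is nonzero,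
    and for odd \<open>p\<close> it already determines the square class.\<close>
  define g where "g s = x' * s\<^sup>2 mod P ^ Suc j" for s
  define T where "T = g ` {1..int h}"
  have inj: "inj_on g {1..int h}"
  proof (rule inj_onI)
    fix s t assume st: "s \<in> {1..int h}" "t \<in> {1..int h}" "g s = g t"
    then have "P ^ Suc j dvd x' * s\<^sup>2 - x' * t\<^sup>2" by (simp add: g_def mod_eq_dvd_iff)
    then have "P ^ j * P dvd P ^ j * (z * (s\<^sup>2 - t\<^sup>2))" by (simp add: z algebra_simps)
    then have "P dvd z * (s\<^sup>2 - t\<^sup>2)" using P0 by (subst (asm) dvd_times_left_cancel_iff) auto
    then have "P dvd s\<^sup>2 - t\<^sup>2" using zP pP by (simp add: prime_dvd_mult_iff)
    moreover have "s\<^sup>2 - t\<^sup>2 = (s - t) * (s + t)" by (simp add: power2_eq_square algebra_simps)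
    ultimately have "P dvd (s - t) * (s + t)" by simp
    then have "P dvd s - t \<or> P dvd s + t" using pP by (simp add: prime_dvd_mult_iff)
    \<comment> \<open>\<open>0 < s + t \<le> 2 * h < p\<close> excludes the sign ambiguity.\<close>
    moreover have "\<not> P dvd s + t" using st h by (intro zdvd_not_zless) (auto simp: P_def)
    ultimately have "P dvd s - t" by simp
    moreover have "\<bar>s - t\<bar> < P" using st h by (auto simp: P_def)
    ultimately show "s = t" using dvd_imp_le_int[of "s - t" P] P0 by force
  qed
  have disj: "padic_ball p (Suc j) r \<inter> V = {}" if rT: "r \<in> T" for r
  proof (rule ccontr)
    assume "padic_ball p (Suc j) r \<inter> V \<noteq> {}"
    then obtain y where y: "y \<in> V" "y (Suc j) = r" "y \<in> carrier (padic_int p)"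
      by (auto simp: padic_ball_def)
    obtain s where s: "s \<in> {1..int h}" "r = g s" using rT by (auto simp: T_def)
    have "\<not> P dvd s" using s h by (intro zdvd_not_zless) (auto simp: P_def)
    then have "coprime s P" using pP by (metis prime_imp_coprime coprime_commute)
    \<comment> \<open>With \<open>t\<close> inverse to \<open>s\<close> modulo \<open>p\<close>,
      multiplying \<open>y\<close> by \<open>t * t\<close> leads back to the ball of
      \<open>x\<close>, which would put \<open>x\<close> into \<open>V\<close>.\<close>
    then obtain t where "[s * t = 1] (mod P)" using cong_solve_coprime_int by blast
    then have "P dvd s * t - 1" by (simp add: cong_iff_dvd_diff)
    then have "P dvd (s * t - 1) * (s * t + 1)" by (rule dvd_mult2)
    then have "P dvd (s * t)\<^sup>2 - 1" by (simp add: power2_eq_square algebra_simps)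
    then have "P ^ j * P dvd P ^ j * (z * ((s * t)\<^sup>2 - 1))" by (intro mult_dvd_mono dvd_mult) auto
    moreover have "P ^ j * (z * ((s * t)\<^sup>2 - 1)) = x' * (s * t)\<^sup>2 - x'" by (simp add: z algebra_simps)
    ultimately have st: "(x' * (s * t)\<^sup>2) mod P ^ Suc j = x' mod P ^ Suc j"
      unfolding mod_eq_dvd_iff by (simp only: power_Suc2)
    define u where "u = padic_of_int p t"
    define y' where "y' = u \<otimes>\<^bsub>padic_int p\<^esub> u \<otimes>\<^bsub>padic_int p\<^esub> y"
    have "y' \<in> V" unfolding y'_def u_def by (intro square_mult y padic_of_int_carrier p_pos)
    have "y' (Suc j) = (t * t * y (Suc j)) mod P ^ Suc j"
      by (simp add: y'_def u_def padic_of_int_def padic_int_simps mod_simps P_def)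
    also have "\<dots> = (x' * (s * t)\<^sup>2) mod P ^ Suc j"
      unfolding y s g_def mod_mult_right_eq by (simp add: power2_eq_square algebra_simps)
    also have "\<dots> = x (Suc j)"
      using st padic_int_memD(4)[OF x(1), of "Suc j"] by (simp add: x'_def P_def)
    finally have eq: "y' (Suc j) = x (Suc j)" .
    moreover have "y' \<in> carrier (padic_int p)" using \<open>y' \<in> V\<close> subset by blast
    ultimately have "y' j = x j" using padic_int_memD(3) x(1) by metis
    then have "x \<in> V" using mem_cong_imp[OF \<open>y' \<in> V\<close> x(1), of j] eq xj odd by simp
    then show False using x by simp
  qed
  have T: "T \<subseteq> {0..<int p ^ Suc j}" using P0 by (auto simp: T_def g_def P_def)
  have "card T = h" using card_image[OF inj] by (simp add: T_def)
  then have mT: "measure (padic_haar p) (\<Union>r\<in>T. padic_ball p (Suc j) r) = h / real p ^ Suc j"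
    using measure_balls[OF T] by simp
  have "finite T" by (simp add: T_def)
  have "measure (padic_haar p) V + measure (padic_haar p) (\<Union>r\<in>T. padic_ball p (Suc j) r)
      = measure (padic_haar p) (V \<union> (\<Union>r\<in>T. padic_ball p (Suc j) r))"
    using disj \<open>finite T\<close>
    by (intro haar.finite_measure_Union[symmetric] sets.finite_UN) (auto simp: sets_haar sets_V)
  also have "\<dots> \<le> 1" by simp
  finally have "measure (padic_haar p) V + h / real p ^ Suc j \<le> 1" using mT by simp
  moreover have "(real p - 1) / (2 * real p ^ Suc j) = h / real p ^ Suc j"
    by (subst (1) h) simp
  ultimately show ?thesis by linarith
qed

text \<open>A missing integer of valuation 0 or 1 feeds \<open>measure_le_of_missing\<close> with
  \<open>j = 0\<close> or \<open>j = 1\<close>; the stated bounds follow from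
  \<open>(p - 1) / (2 * p) \<ge> 1 / 3\<close> for \<open>p \<ge> 3\<close>.\<close>

lemma measure_defect:
  assumes odd: "p \<noteq> 2"
  shows "measure (padic_haar p) V \<le> 2 / 3 \<or>
    (\<forall>m. \<not> int p dvd m \<longrightarrow> m \<in> W) \<and> measure (padic_haar p) V \<le> 1 - 1 / (3 * real p) \<or> W = UNIV"
proof -
  have p3: "real p \<ge> 3" using odd prime prime_ge_2_nat[of p] by linarith
  consider m where "\<not> int p dvd m" "m \<notin> W"
    | m where "\<forall>m. \<not> int p dvd m \<longrightarrow> m \<in> W" "int p dvd m" "\<not> (int p)\<^sup>2 dvd m" "m \<notin> W"
    | "\<And>m. \<not> (int p)\<^sup>2 dvd m \<Longrightarrow> m \<in> W"
    by blast
  then show ?thesis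
  proof cases
    case 1
    then have "measure (padic_haar p) V \<le> 1 - (real p - 1) / (2 * real p ^ Suc 0)"
      by (intro measure_le_of_missing[OF odd, of "padic_of_int p m"])
         (auto simp: W_def padic_of_int_def dvd_eq_mod_eq_0 intro: padic_of_int_carrier[OF p_pos, unfolded padic_of_int_def])
    also have "\<dots> \<le> 2 / 3" using p3 by (simp add: field_simps)
    finally show ?thesis by simp
  next
    case 2
    then have "measure (padic_haar p) V \<le> 1 - (real p - 1) / (2 * real p ^ Suc 1)"
      by (intro measure_le_of_missing[OF odd, of "padic_of_int p m"])
         (auto simp: W_def padic_of_int_def dvd_eq_mod_eq_0 power2_eq_square
           intro: padic_of_int_carrier[OF p_pos, unfolded padic_of_int_def])
    also have "\<dots> \<le> 1 - 1 / (3 * real p)" using p3 by (simp add: field_simps)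
    finally show ?thesis using 2 by simp
  next
    case 3
    \<comment> \<open>Descent: a nonzero integer becomes one not divisible by \<open>p ^ 2\<close>
      after removing factors \<open>p ^ 2\<close>, and restoring these preserves membership.\<close>
    have "m \<in> W" for m
    proof (induction "nat \<bar>m\<bar>" arbitrary: m rule: less_induct)
      case less
      consider "m = 0" | "\<not> (int p)\<^sup>2 dvd m" | "m \<noteq> 0" "(int p)\<^sup>2 dvd m" by blast
      then show ?case
      proof cases
        case 1
        then show ?thesis using zero_mem by (simp add: W_def padic_of_int_def)
      next
        case 3
        then obtain m' where m': "m = int p * int p * m'" by (auto simp: power2_eq_square elim: dvdE)
        have "1 * \<bar>m'\<bar> < (int p * int p) * \<bar>m'\<bar>"
          using p3 m' 3 by (intro mult_strict_right_mono) (auto simp: less_1_mult)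
        then have "nat \<bar>m'\<bar> < nat \<bar>m\<bar>" by (simp add: m' abs_mult)
        then have "m' \<in> W" by (rule less)
        then have "padic_of_int p (int p) \<otimes>\<^bsub>padic_int p\<^esub> padic_of_int p (int p) \<otimes>\<^bsub>padic_int p\<^esub> padic_of_int p m' \<in> V"
          unfolding W_def by (intro square_mult padic_of_int_carrier p_pos) simp
        then show ?thesis by (simp add: W_def padic_of_int_mult m')
      qed (rule 3)
    qed
    then show ?thesis by blast
  qed
qed

end


section \<open>Value sets of quadratic forms\<close>

text \<open>Identifies the canonical image of an integer in a concrete ring: additivity and the
  value at 1 determine it.\<close>

lemma (in ring) add_pow_one_eqI:
  fixes m :: int
  assumes "\<And>m. \<phi> m \<in> carrier R" "\<phi> 0 = \<zero>" "\<phi> 1 = \<one>" "\<And>a b :: int. \<phi> (a + b) = \<phi> a \<oplus> \<phi> b"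
  shows "[m] \<cdot>\<^bsub>R\<^esub> \<one> = \<phi> m"
proof (induction m rule: int_induct[where k = 0])
  case base
  have "[(0 :: int)] \<cdot>\<^bsub>R\<^esub> \<one> = \<zero>" unfolding add_pow_def int_pow_def2 by simp
  then show ?case by (simp add: assms)
next
  case (step1 i)
  then show ?case by (simp add: assms add.int_pow_mult)
next
  case (step2 i)
  have "[(i - 1)] \<cdot>\<^bsub>R\<^esub> \<one> \<oplus> \<one> = [i] \<cdot>\<^bsub>R\<^esub> \<one>" using add.int_pow_mult[of \<one> "i - 1" 1] by simp
  also have "\<dots> = \<phi> (i - 1) \<oplus> \<one>" using step2 assms(4)[of "i - 1" 1] assms(3) by simp
  finally show ?case using assms(1) by simp
qed

lemma padic_int_pow_one:
  fixes m :: int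
  assumes "p > 0"
  shows "[m] \<cdot>\<^bsub>padic_int p\<^esub> \<one>\<^bsub>padic_int p\<^esub> = padic_of_int p m"
proof -
  interpret cring "padic_int p" by (rule cring_padic_int[OF assms])
  show ?thesis
    by (rule add_pow_one_eqI)
       (use padic_of_int_carrier[OF assms] in \<open>auto simp: padic_of_int_def padic_int_simps(3-5) mod_simps\<close>)
qed

lemma real_pow_one:
  fixes m :: int
  shows "[m] \<cdot>\<^bsub>ring_of_type_algebra\<^esub> \<one>\<^bsub>ring_of_type_algebra\<^esub> = (of_int m :: real)"
proof -
  interpret cring "ring_of_type_algebra :: real ring" by (rule cring_from_type_algebra)
  show ?thesis by (rule add_pow_one_eqI) (auto simp: ring_of_type_algebra_def)
qed

text \<open>Homogeneity of degree 2; over the p-adic integers it makes the value set stable under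
  multiplication by squares.\<close>

lemma (in cring) qf_eval_scale:
  assumes x: "x \<in> {..<n} \<rightarrow> carrier R" and u: "u \<in> carrier R"
  shows "qf_eval R n c x \<in> carrier R"
    and "qf_eval R n c (\<lambda>i. u \<otimes> x i) = u \<otimes> u \<otimes> qf_eval R n c x"
proof -
  have xi: "x i \<in> carrier R" if "i < n" for i using x that by auto
  have xij: "x i \<in> carrier R" "x j \<in> carrier R" if "j < n" "i \<le> j" for i j
    using x that by (auto intro!: xi)
  show "qf_eval R n c x \<in> carrier R"
    unfolding qf_eval_def using xij by (intro finsum_closed) (auto intro!: finsum_closed)
  have "u \<otimes> u \<otimes> qf_eval R n c x
      = (\<Oplus>j\<in>{..<n}. u \<otimes> u \<otimes> (\<Oplus>i\<in>{..j}. [c i j] \<cdot>\<^bsub>R\<^esub> (x i \<otimes> x j)))"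
    unfolding qf_eval_def using xij u by (intro finsum_rdistr) (auto intro!: finsum_closed)
  also have "\<dots> = (\<Oplus>j\<in>{..<n}. \<Oplus>i\<in>{..j}. [c i j] \<cdot>\<^bsub>R\<^esub> ((u \<otimes> x i) \<otimes> (u \<otimes> x j)))"
  proof (intro finsum_cong' refl)
    fix j assume "j \<in> {..<n}"
    then have j: "j < n" by simp
    have "u \<otimes> u \<otimes> (\<Oplus>i\<in>{..j}. [c i j] \<cdot>\<^bsub>R\<^esub> (x i \<otimes> x j)) = (\<Oplus>i\<in>{..j}. u \<otimes> u \<otimes> ([c i j] \<cdot>\<^bsub>R\<^esub> (x i \<otimes> x j)))"
      using xij[OF j] u by (intro finsum_rdistr) auto
    also have "\<dots> = (\<Oplus>i\<in>{..j}. [c i j] \<cdot>\<^bsub>R\<^esub> ((u \<otimes> x i) \<otimes> (u \<otimes> x j)))"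
    proof (intro finsum_cong' refl)
      fix i assume "i \<in> {..j}"
      then have "x i \<in> carrier R" "x j \<in> carrier R" using xij[OF j] by auto
      then show "u \<otimes> u \<otimes> ([c i j] \<cdot>\<^bsub>R\<^esub> (x i \<otimes> x j)) = [c i j] \<cdot>\<^bsub>R\<^esub> ((u \<otimes> x i) \<otimes> (u \<otimes> x j))"
        using u by (simp add: add_pow_rdistr_int m_ac)
    qed (use xij[OF j] u in auto)
    finally show "u \<otimes> u \<otimes> (\<Oplus>i\<in>{..j}. [c i j] \<cdot>\<^bsub>R\<^esub> (x i \<otimes> x j))
      = (\<Oplus>i\<in>{..j}. [c i j] \<cdot>\<^bsub>R\<^esub> ((u \<otimes> x i) \<otimes> (u \<otimes> x j)))" .
  qed (use xij u in \<open>auto intro!: finsum_closed\<close>)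
  finally show "qf_eval R n c (\<lambda>i. u \<otimes> x i) = u \<otimes> u \<otimes> qf_eval R n c x"
    by (simp add: qf_eval_def)
qed

lemma padic_square_closed_qf_values:
  assumes "prime p"
  shows "padic_square_closed p (qf_values (padic_int p) n c)"
proof -
  interpret cring "padic_int p" by (rule cring_padic_int) (use assms in \<open>simp add: prime_gt_0_nat\<close>)
  let ?R = "padic_int p"
  show ?thesis
  proof
    show "qf_values ?R n c \<subseteq> carrier ?R"
      using qf_eval_scale(1)[OF _ one_closed] by (auto simp: qf_values_def)
    show "qf_values ?R n c \<noteq> {}" unfolding qf_values_def using zero_closed by fastforce
    fix v u assume v: "v \<in> qf_values ?R n c" and u: "u \<in> carrier ?R"
    then obtain x where x: "x \<in> {..<n} \<rightarrow> carrier ?R" "v = qf_eval ?R n c x" by (auto simp: qf_values_def)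
    have "(\<lambda>i. u \<otimes>\<^bsub>?R\<^esub> x i) \<in> {..<n} \<rightarrow> carrier ?R" using x u by auto
    then show "u \<otimes>\<^bsub>?R\<^esub> u \<otimes>\<^bsub>?R\<^esub> v \<in> qf_values ?R n c"
      unfolding qf_values_def x(2) using qf_eval_scale(2)[OF x(1) u] by (metis image_eqI)
  qed (rule assms)
qed

lemma qf_represents_padic_iff:
  assumes "prime p"
  shows "qf_represents (padic_int p) n c m \<longleftrightarrow> padic_of_int p m \<in> qf_values (padic_int p) n c"
  using assms by (simp add: qf_represents_def padic_int_pow_one prime_gt_0_nat)

lemma local_densities_qf:
  "local_densities (\<lambda>p. {m. qf_represents (padic_int p) n c m}) (\<lambda>p. local_measure p n c)"
proof
  fix p k :: nat assume p: "prime p"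
  interpret padic_square_closed p "qf_values (padic_int p) n c"
    by (rule padic_square_closed_qf_values[OF p])
  have W: "{m. qf_represents (padic_int p) n c m} = W"
    by (simp add: W_def qf_represents_padic_iff[OF p])
  show "mod_periodic (p ^ (k + 3)) ({m. qf_represents (padic_int p) n c m} - {m. int (p ^ k) dvd m})"
    unfolding W by (rule W_periodic)
  show "\<bar>card (({m. qf_represents (padic_int p) n c m} - {m. int (p ^ k) dvd m}) \<inter> {0..<int (p ^ (k + 3))})
      / real p ^ (k + 3) - local_measure p n c\<bar> \<le> 1 / real p ^ k"
    unfolding W local_measure_def by (rule measure_approx)
  show "0 \<le> local_measure p n c" "local_measure p n c \<le> 1" by (simp_all add: local_measure_def)
  show "local_measure p n c \<le> 2 / 3 \<or>
      (\<forall>m. \<not> int p dvd m \<longrightarrow> m \<in> {m. qf_represents (padic_int p) n c m})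
        \<and> local_measure p n c \<le> 1 - 1 / (3 * real p) \<or>
      {m. qf_represents (padic_int p) n c m} = UNIV" if "p \<noteq> 2"
    unfolding W local_measure_def by (rule measure_defect[OF that])
qed

section \<open>Values of the form over the reals\<close>

definition real_qf :: "nat \<Rightarrow> (nat \<Rightarrow> nat \<Rightarrow> int) \<Rightarrow> (nat \<Rightarrow> real) \<Rightarrow> real" where
  "real_qf n c x = (\<Sum>j<n. \<Sum>i\<le>j. of_int (c i j) * (x i * x j))"

lemma real_qf_scale: "real_qf n c (\<lambda>i. t * x i) = t\<^sup>2 * real_qf n c x"
  unfolding real_qf_def sum_distrib_left by (intro sum.cong refl) (simp add: power2_eq_square mult_ac)

lemma qf_represents_real_iff:
  "qf_represents (ring_of_type_algebra :: real ring) n c m \<longleftrightarrow> (\<exists>x. real_qf n c x = of_int m)"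
proof -
  have "carrier (ring_of_type_algebra :: real ring) = UNIV" by (simp add: ring_of_type_algebra_def)
  then show ?thesis
    unfolding qf_represents_def qf_values_def real_pow_one real_qf_def qf_eval_type
    by (simp add: image_iff eq_commute)
qed

text \<open>Scaling a vector of value \<open>a\<close> by \<open>sqrt (m / a)\<close> gives the
  value \<open>m\<close>. Hence the integers of a given sign are represented over the reals either
  all or not at all.\<close>

lemma qf_represents_real_same_sign:
  assumes "real_qf n c x * of_int m > 0"
  shows "qf_represents (ring_of_type_algebra :: real ring) n c m"
proof -
  define a where "a = real_qf n c x"
  have "a \<noteq> 0" "of_int m / a > 0" using assms by (auto simp: a_def zero_less_mult_iff zero_less_divide_iff)
  then have "real_qf n c (\<lambda>i. sqrt (of_int m / a) * x i) = of_int m"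
    unfolding real_qf_scale by (simp flip: a_def)
  then show ?thesis by (auto simp: qf_represents_real_iff)
qed

text \<open>A form vanishing on real vectors vanishes on rational ones, so its polar form is zero
  and every vector lies in the radical. The constant vector 1 then rules out any coordinate.\<close>

lemma qf_nondegenerate_zero:
  assumes "qf_nondegenerate n c" "\<And>x. real_qf n c x = 0"
  shows "n = 0"
proof -
  have "qf_eval ring_of_type_algebra n c x = 0" for x :: "nat \<Rightarrow> rat"
  proof -
    have "of_rat (qf_eval ring_of_type_algebra n c x) = real_qf n c (\<lambda>i. of_rat (x i))"
      by (simp add: qf_eval_type real_qf_def of_rat_sum of_rat_mult)
    then show ?thesis using assms(2) by simp
  qed
  then have "qf_polar n c x y = 0" for x y by (simp add: qf_polar_def)
  then show ?thesis using assms(1) unfolding qf_nondegenerate_def by (auto dest!: spec[of _ "\<lambda>_. 1"])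
qed

section \<open>From one-sided densities to the sign-dependent density\<close>

lemma has_pos_density_unique: "has_pos_density S a \<Longrightarrow> has_pos_density S b \<Longrightarrow> a = b"
  unfolding has_pos_density_def by (rule LIMSEQ_unique)

lemma has_pos_density_empty: "S \<inter> {0<..} = {} \<Longrightarrow> has_pos_density S 0"
proof -
  assume "S \<inter> {0<..} = {}"
  then have "S \<inter> {1..int N} = {}" for N by force
  then show ?thesis by (simp add: has_pos_density_def)
qed

lemma has_pos_density_cong: "S \<inter> {0<..} = T \<inter> {0<..} \<Longrightarrow> has_pos_density S a \<longleftrightarrow> has_pos_density T a"
proof -
  assume "S \<inter> {0<..} = T \<inter> {0<..}"
  moreover have "A \<inter> {1..int N} = A \<inter> {0<..} \<inter> {1..int N}" for A and N :: nat by auto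
  ultimately have "S \<inter> {1..int N} = T \<inter> {1..int N}" for N by metis
  then show ?thesis by (simp add: has_pos_density_def)
qed

lemma card_uminus_vimage: "card (S \<inter> {- int N..-1}) = card (uminus -` S \<inter> {1..int N})"
proof -
  have "uminus ` (uminus -` S \<inter> {1..int N}) = S \<inter> {- int N..-1}"
    by (auto intro!: image_eqI[of _ _ "- _"])
  then show ?thesis by (metis card_image inj_on_def neg_equal_iff_equal)
qed

text \<open>\<open>has_density\<close> distinguishes cases by the signs in
  \<open>F \<inter> R\<close>, which need not match those in \<open>R\<close>: a half-line inside
  \<open>R\<close> may fail to meet \<open>F\<close>. That forces \<open>\<delta> = 0\<close>, so
  every case yields the same limit.\<close>

lemma has_density_inter_sign:
  assumes F: "has_pos_density F \<delta>" "has_pos_density (uminus -` F) \<delta>"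
    and pos: "{0<..} \<subseteq> R \<or> R \<inter> {0<..} = {}" and neg: "{..<0} \<subseteq> R \<or> R \<inter> {..<0} = {}"
    and triv: "R \<inter> {0<..} = {} \<Longrightarrow> R \<inter> {..<0} = {} \<Longrightarrow> \<delta> = 0"
    and zero: "0 \<in> F" "0 \<in> R"
  shows "has_density (F \<inter> R) \<delta>"
proof -
  have P: "has_pos_density (F \<inter> R) \<delta>" if "{0<..} \<subseteq> R"
    using F(1) that by (subst has_pos_density_cong[of _ F]) auto
  have N: "has_pos_density (uminus -` (F \<inter> R)) \<delta>" if "{..<0} \<subseteq> R"
    using F(2) that by (subst has_pos_density_cong[of _ "uminus -` F"]) (auto simp: subset_iff)
  consider "\<forall>m\<in>F \<inter> R. \<not> m < 0" | "\<exists>m\<in>F \<inter> R. m < 0" "\<forall>m\<in>F \<inter> R. \<not> m > 0"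
    | "\<exists>m\<in>F \<inter> R. m < 0" "\<exists>m\<in>F \<inter> R. m > 0"
    by blast
  then show ?thesis
  proof cases
    case 1
    have "has_pos_density (F \<inter> R) \<delta>"
    proof (cases "{0<..} \<subseteq> R")
      case False
      then have R: "R \<inter> {0<..} = {}" using pos by blast
      have "\<delta> = 0"
      proof (cases "{..<0} \<subseteq> R")
        case True
        have "- m \<notin> F" if "m > 0" for m
        proof
          assume "- m \<in> F"
          then have "- m \<in> F \<inter> R" using True that by auto
          then show False using 1 that by force
        qed
        then have "uminus -` F \<inter> {0<..} = {}" by auto
        then show ?thesis using F(2) has_pos_density_empty has_pos_density_unique by blast
      qed (use neg triv R in blast)
      then show ?thesis using has_pos_density_empty[of "F \<inter> R"] R by auto
    qed (rule P)
    then show ?thesis using 1 by (simp add: has_density_def has_pos_density_def)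
  next
    case 2
    then have "{..<0} \<subseteq> R" using neg by auto
    with N have "(\<lambda>N. real (card (F \<inter> R \<inter> {- int N..-1})) / real N) \<longlonglongrightarrow> \<delta>"
      unfolding has_pos_density_def card_uminus_vimage by simp
    then show ?thesis using 2 unfolding has_density_def by auto
  next
    case 3
    then have R: "{..<0} \<subseteq> R" "{0<..} \<subseteq> R" using pos neg by auto
    have lim: "(\<lambda>N. real (card (F \<inter> R \<inter> {1..int N})) / real N) \<longlonglongrightarrow> \<delta>"
      "(\<lambda>N. real (card (F \<inter> R \<inter> {- int N..-1})) / real N) \<longlonglongrightarrow> \<delta>"
      using P[OF R(2)] N[OF R(1)] unfolding has_pos_density_def card_uminus_vimage by simp_all
    \<comment> \<open>The integer 0 is counted once more; its share \<open>1 / N\<close> vanishes in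
      the limit.\<close>
    have card: "card (F \<inter> R \<inter> {- int N..int N})
        = card (F \<inter> R \<inter> {1..int N}) + card (F \<inter> R \<inter> {- int N..-1}) + 1" for N
    proof -
      have "F \<inter> R \<inter> {- int N..int N} = insert 0 ((F \<inter> R \<inter> {1..int N}) \<union> (F \<inter> R \<inter> {- int N..-1}))"
        using zero by auto
      also have "card \<dots> = card (F \<inter> R \<inter> {1..int N}) + card (F \<inter> R \<inter> {- int N..-1}) + 1"
        by (subst card_insert_disjoint) (auto intro!: card_Un_disjoint)
      finally show ?thesis .
    qed
    have "(\<lambda>N. (real (card (F \<inter> R \<inter> {1..int N})) / real N
        + real (card (F \<inter> R \<inter> {- int N..-1})) / real N + 1 / real N) / 2) \<longlonglongrightarrow> (\<delta> + \<delta> + 0) / 2"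
      by (intro tendsto_intros lim lim_1_over_n) simp
    then have "(\<lambda>N. real (card (F \<inter> R \<inter> {- int N..int N})) / (2 * real N)) \<longlonglongrightarrow> \<delta>"
      unfolding card by (simp add: add_divide_distrib mult.commute add_ac)
    then show ?thesis using 3 unfolding has_density_def by auto
  qed
qed

text \<open>With no variables the only value is 0. At the prime 2 this makes \<open>m\<close>
  divisible by \<open>2 ^ nat \<bar>m\<bar>\<close>, which exceeds
  \<open>\<bar>m\<bar>\<close>.\<close>

lemma locally_represented_zero_dim:
  assumes "\<forall>p. prime p \<longrightarrow> qf_represents (padic_int p) 0 c m"
  shows "m = 0"
proof (rule ccontr)
  interpret cring "padic_int 2" by (rule cring_padic_int) simp
  assume "m \<noteq> 0"
  have "qf_represents (padic_int 2) 0 c m" using assms by simp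
  then have "padic_of_int 2 m \<in> qf_values (padic_int 2) 0 c" by (simp add: qf_represents_padic_iff)
  then have "padic_of_int 2 m = (\<lambda>k. 0)"
    by (auto simp: qf_values_def qf_eval_def padic_int_simps(4))
  then have "m mod 2 ^ nat \<bar>m\<bar> = 0" by (metis of_nat_numeral padic_of_int_def)
  then have "2 ^ nat \<bar>m\<bar> dvd m" by (simp add: dvd_eq_mod_eq_0)
  then have "2 ^ nat \<bar>m\<bar> \<le> \<bar>m\<bar>" using \<open>m \<noteq> 0\<close> by (metis dvd_imp_le_int abs_numeral power_abs)
  moreover have "int (nat \<bar>m\<bar>) < int (2 ^ nat \<bar>m\<bar>)" by (simp only: of_nat_less_iff less_exp)
  ultimately show False by simp
qed

section \<open>Combining the real and the p-adic conditions\<close>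

theorem theorem1p20:
  fixes n :: nat and f :: "nat \<Rightarrow> nat \<Rightarrow> int"
  assumes "qf_nondegenerate n f"
  shows "\<exists>\<delta>. has_density (locally_represented n f) \<delta> \<and>
    (\<lambda>N::nat. \<Prod>p | prime p \<and> p \<le> N. local_measure p n f) \<longlonglongrightarrow> \<delta>"
proof -
  define W where "W p = {m. qf_represents (padic_int p) n f m}" for p
  define F where "F = {m. \<forall>p. prime p \<longrightarrow> m \<in> W p}"
  define R where "R = {m. qf_represents (ring_of_type_algebra :: real ring) n f m}"
  interpret L: local_densities W "\<lambda>p. local_measure p n f"
    unfolding W_def by (rule local_densities_qf)
  interpret L': local_densities "\<lambda>p. uminus -` W p" "\<lambda>p. local_measure p n f"
    by (rule L.reflect)
  obtain \<delta> where \<delta>: "(\<lambda>N. \<Prod>p | prime p \<and> p \<le> N. local_measure p n f) \<longlonglongrightarrow> \<delta>" "has_pos_density F \<delta>"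
    using L.density_product unfolding F_def by blast
  have "uminus -` F = {m. \<forall>p. prime p \<longrightarrow> m \<in> uminus -` W p}" by (auto simp: F_def)
  \<comment> \<open>The reflected problem has the same partial products, so its density is the same
    \<open>\<delta>\<close>.\<close>
  then have F': "has_pos_density (uminus -` F) \<delta>"
    using L'.density_product LIMSEQ_unique[OF \<delta>(1)] by metis
  have R_iff: "m \<in> R \<longleftrightarrow> (\<exists>x. real_qf n f x = of_int m)" for m
    by (simp add: R_def qf_represents_real_iff)
  have R_sign: "m \<in> R" if "real_qf n f x * of_int m > 0" for x m
    using qf_represents_real_same_sign[OF that] by (simp add: R_def)
  have 0: "real_qf n f (\<lambda>_. 0) = 0" by (simp add: real_qf_def)
  have "has_density (F \<inter> R) \<delta>"
  proof (rule has_density_inter_sign[OF \<delta>(2) F'])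
    show "{0<..} \<subseteq> R \<or> R \<inter> {0<..} = {}"
    proof (rule disjCI)
      assume "R \<inter> {0<..} \<noteq> {}"
      then obtain x a where "real_qf n f x = of_int a" "a > 0" by (auto simp: R_iff)
      then show "{0<..} \<subseteq> R" using R_sign[of x] by auto
    qed
    show "{..<0} \<subseteq> R \<or> R \<inter> {..<0} = {}"
    proof (rule disjCI)
      assume "R \<inter> {..<0} \<noteq> {}"
      then obtain x a where "real_qf n f x = of_int a" "a < 0" by (auto simp: R_iff)
      then show "{..<0} \<subseteq> R" using R_sign[of x] by (auto simp: zero_less_mult_iff)
    qed
    show "0 \<in> R" unfolding R_iff using 0 by auto
    show "0 \<in> F"
    proof -
      have "0 \<in> W p" if "prime p" for p
        using padic_square_closed.zero_mem[OF padic_square_closed_qf_values[OF that]]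
        by (simp add: W_def qf_represents_padic_iff[OF that] padic_of_int_def)
      then show ?thesis by (simp add: F_def)
    qed
    \<comment> \<open>If no nonzero integer is represented over the reals, the form vanishes
      identically; nondegeneracy gives \<open>n = 0\<close>, and then \<open>F\<close> contains only
      0.\<close>
    assume R: "R \<inter> {0<..} = {}" "R \<inter> {..<0} = {}"
    have "real_qf n f x = 0" for x
      using R R_sign[of x 1] R_sign[of x "-1"] by (cases "real_qf n f x" "0::real" rule: linorder_cases) auto
    then have "n = 0" using qf_nondegenerate_zero[OF assms] by blast
    then have "m = 0" if "m \<in> F" for m
      using that locally_represented_zero_dim[of f m] by (simp add: F_def W_def)
    then have "F \<inter> {0<..} = {}" by force
    then show "\<delta> = 0" using \<delta>(2) has_pos_density_empty has_pos_density_unique by blast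
  qed
  moreover have "locally_represented n f = F \<inter> R"
    by (auto simp: locally_represented_def F_def R_def W_def)
  ultimately show ?thesis using \<delta>(1) by auto
qed

end
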